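(* For every integer $k\ge 2$ and every positive integer $n$, \[ \mathrm{ex}^{\mathrm{lin}}_3\big(n, C^{(3)}_{2k+1}\big)\le 2k\,n^{1+1/k}+9kn. \]
   Context: A 3-uniform hypergraph is linear if any two distinct hyperedges share at most one vertex. A Berge cycle of length $m$ is a family of $m$ distinct hyperedges $H_0,\dots,H_{m-1}$ for which there exist distinct vertices $v_0,\dots,v_{m-1}$ with $\{v_i,v_{i+1}\}\subset H_i$ for $0\le i\le m-1$ (indices mod $m$). $\mathrm{ex}^{\mathrm{lin}}_3(n,C^{(3)}_m)$ is the maximum number of hyperedges in a 3-uniform linear hypergraph on $n$ vertices containing no Berge cycle of length $m$. *)

theory Defs
  imports Complex_Main
begin

definition uniform3_on :: "'a set \<Rightarrow> 'a set set \<Rightarrow> bool" where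
  "uniform3_on V H \<longleftrightarrow> (\<forall>e\<in>H. e \<subseteq> V \<and> card e = 3)"

definition linear_hg :: "'a set set \<Rightarrow> bool" where
  "linear_hg H \<longleftrightarrow> (\<forall>e\<in>H. \<forall>f\<in>H. e \<noteq> f \<longrightarrow> card (e \<inter> f) \<le> 1)"

definition has_berge_cycle :: "'a set set \<Rightarrow> nat \<Rightarrow> bool" where
  "has_berge_cycle H m \<longleftrightarrow>
     (\<exists>E v. inj_on E {..<m} \<and> E ` {..<m} \<subseteq> H \<and> inj_on v {..<m} \<and>
        (\<forall>i<m. {v i, v ((i + 1) mod m)} \<subseteq> E i))"

definition ex_lin3 :: "nat \<Rightarrow> nat \<Rightarrow> nat" where
  "ex_lin3 n m = Max {card H | H :: nat set set.
      uniform3_on {..<n} H \<and> linear_hg H \<and> \<not> has_berge_cycle H m}"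

end

theory Submission
  imports Defs
begin

text \<open>A hypergraph with too many edges contains one in which every degree exceeds
  \<open>2k n\<^sup>1\<^sup>/\<^sup>k + 9k\<close>. Grow a breadth-first tree in it, with levels \<open>V\<^sub>0, \<dots>, V\<^sub>k\<close>. The key claim is that at
  most \<open>(2k - 2)|V\<^sub>i|\<close> non-tree edges meet \<open>V\<^sub>i\<close> in two or more vertices. Otherwise the pairs they cut
  out of \<open>V\<^sub>i\<close> form a graph with a connected subgraph of minimum degree \<open>2k - 1\<close>; two of its vertices
  whose tree paths branch at a suitable level are joined by a path in it of prescribed length, and
  the tree closes this path to a Berge cycle of length \<open>2k + 1\<close>. Counting degrees over \<open>V\<^sub>i\<close> then gives
  \<open>|V\<^sub>i\<^sub>+\<^sub>1| > n\<^sup>1\<^sup>/\<^sup>k |V\<^sub>i|\<close>, hence \<open>|V\<^sub>k| > n\<close>, a contradiction.\<close>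

text \<open>The cycle length has to be hit exactly. For two vertices of level i whose ancestors
  first differ at level l, the tree contributes 2(i - l) + 2 edges, or one fewer when the two
  branches start in the same triple. The connecting path must therefore have odd length in the first
  case and even length in the second. For l < i, a path of this length between different branches
  exists unless the branches colour the graph properly. For odd lengths this exception is
  contradictory. For even lengths it is a real obstacle, since in a bipartite graph no even path
  joins the two classes; hence the separate treatment of the shared triple. The constants come from
  the degree sum over level i. Non-tree edges contribute at most 3(2k - 2) times the size of level
  i, plus (2k - 2) times the size of each adjacent level. Tree edges add twice the sizes of levels i
  and i + 1. If level i - 1 is no larger than level i, the coefficients are 8k - 6 < 9k for level i
  and 2k for level i + 1.\<close>

text \<open>Take \<open>U\<close> of least size containing more than \<open>c * card U\<close>
  members: deleting \<open>u\<close> must destroy this property, so more than \<open>c\<close> of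
  the members inside \<open>U\<close> use \<open>u\<close>. It serves twice, for the triples
  themselves and for pairs chosen inside triples.\<close>

lemma dense_family_min_degree:
  fixes c :: real and p :: "'b \<Rightarrow> 'a set"
  assumes "finite V" "finite Q"
    and pV: "\<And>f. f \<in> Q \<Longrightarrow> p f \<subseteq> V \<and> p f \<noteq> {}"
    and dense: "c * card V < card Q"
  obtains U where "U \<subseteq> V" "U \<noteq> {}"
    "\<And>u. u \<in> U \<Longrightarrow> c < card {f \<in> Q. u \<in> p f \<and> p f \<subseteq> U}"
proof -
  define P where "P U \<longleftrightarrow> U \<subseteq> V \<and> c * card U < card {f \<in> Q. p f \<subseteq> U}" for U
  have "{f \<in> Q. p f \<subseteq> V} = Q" using pV by blast
  then have "P V" using dense by (simp add: P_def)
  then obtain U where PU: "P U" and minU: "\<And>W. P W \<Longrightarrow> card U \<le> card W"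
    using ex_has_least_nat[of P V card] by blast
  have fU: "finite U" using PU assms(1) finite_subset by (auto simp: P_def)
  have "U \<noteq> {}"
  proof
    assume "U = {}"
    then have "{f \<in> Q. p f \<subseteq> U} = {}" using pV by blast
    then have "card {f \<in> Q. p f \<subseteq> U} = 0" by (metis card.empty)
    then show False using PU \<open>U = {}\<close> by (simp add: P_def)
  qed
  moreover have "c < card {f \<in> Q. u \<in> p f \<and> p f \<subseteq> U}" if u: "u \<in> U" for u
  proof -
    have "card (U - {u}) < card U" using u fU by (meson card_Diff1_less)
    then have "\<not> P (U - {u})" using minU[of "U - {u}"] by linarith
    moreover have "U - {u} \<subseteq> V" using PU by (auto simp: P_def)
    ultimately have 1: "card {f \<in> Q. p f \<subseteq> U - {u}} \<le> c * card (U - {u})"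
      unfolding P_def by linarith
    have "{f \<in> Q. p f \<subseteq> U} = {f \<in> Q. p f \<subseteq> U - {u}} \<union> {f \<in> Q. u \<in> p f \<and> p f \<subseteq> U}"
      by blast
    then have "card {f \<in> Q. p f \<subseteq> U}
        \<le> card {f \<in> Q. p f \<subseteq> U - {u}} + card {f \<in> Q. u \<in> p f \<and> p f \<subseteq> U}"
      using card_Un_le by (elim ssubst)
    moreover have "real (card (U - {u})) = real (card U) - 1"
      using card_Suc_Diff1[OF fU u] by linarith
    then have "c * card (U - {u}) = c * card U - c" by (simp only: right_diff_distrib mult_1_right)
    moreover have "c * card U < card {f \<in> Q. p f \<subseteq> U}" using PU by (simp add: P_def)
    ultimately show ?thesis using 1 by linarith
  qed
  moreover have "U \<subseteq> V" using PU by (simp add: P_def)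
  ultimately show ?thesis using that by blast
qed

section \<open>Walks through hyperedges and their closing to Berge cycles\<close>

text \<open>Each entry pairs a hyperedge with the vertex it leads to. The start is not listed, so a
  closed walk lists every vertex once and a Berge cycle amounts to distinctness of both
  projections.\<close>

fun berge_walk :: "'a \<Rightarrow> ('a set \<times> 'a) list \<Rightarrow> 'a \<Rightarrow> bool" where
  "berge_walk u [] w \<longleftrightarrow> u = w"
| "berge_walk u ((e, v) # xs) w \<longleftrightarrow> u \<in> e \<and> v \<in> e \<and> berge_walk v xs w"

lemma berge_walk_trans:
  "berge_walk u xs v \<Longrightarrow> berge_walk v ys w \<Longrightarrow> berge_walk u (xs @ ys) w"
  by (induction u xs v rule: berge_walk.induct) auto

lemma berge_walk_nth:
  "berge_walk u xs w \<Longrightarrow> i < length xs \<Longrightarrow>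
    (u # map snd xs) ! i \<in> fst (xs ! i) \<and> snd (xs ! i) \<in> fst (xs ! i)"
proof (induction u xs w arbitrary: i rule: berge_walk.induct)
  case (2 u e v xs w)
  then show ?case by (cases i) auto
qed simp

lemma berge_walk_last: "berge_walk u xs w \<Longrightarrow> last (u # map snd xs) = w"
  by (induction u xs w rule: berge_walk.induct) (auto split: if_splits)

lemma closed_berge_walk:
  assumes walk: "berge_walk u xs u" and "distinct (map fst xs)" and dv: "distinct (map snd xs)"
    and "fst ` set xs \<subseteq> H" and "length xs = m" and "0 < m"
  shows "has_berge_cycle H m"
proof -
  define E where "E i = fst (xs ! i)" for i
  \<comment> \<open>Entry \<open>i\<close> stores the vertex after edge \<open>i\<close>, whereas
    the cycle needs the one before it; hence the cyclic shift by one.\<close>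
  define v where "v i = snd (xs ! ((i + m - 1) mod m))" for i
  have "xs \<noteq> []" using assms by auto
  then have lastu: "snd (xs ! (m - 1)) = u"
    using berge_walk_last[OF walk] assms(5) by (simp add: last_map) (simp add: last_conv_nth)
  have vS: "v ((i + 1) mod m) = snd (xs ! i)" if "i < m" for i
  proof (cases "i + 1 = m")
    case True
    then show ?thesis using that by (auto simp: v_def)
  next
    case False
    then show ?thesis using that by (simp add: v_def)
  qed
  have v0: "v i = (u # map snd xs) ! i" if "i < m" for i
  proof (cases i)
    case 0
    then show ?thesis using lastu that by (simp add: v_def)
  next
    case (Suc j)
    then show ?thesis using that assms(5) by (simp add: v_def)
  qed
  have "inj_on E {..<m}"
    using assms by (auto simp: E_def inj_on_def distinct_conv_nth)
  moreover have "E ` {..<m} \<subseteq> H" using assms by (auto simp: E_def)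
  moreover have "inj_on v {..<m}"
  proof (rule inj_onI)
    fix i j assume ij: "i \<in> {..<m}" "j \<in> {..<m}" "v i = v j"
    define i' j' where "i' = (i + m - 1) mod m" and "j' = (j + m - 1) mod m"
    have "i' < m" "j' < m" using assms(6) by (auto simp: i'_def j'_def)
    moreover have "map snd xs ! i' = map snd xs ! j'"
      using ij(3) calculation assms(5) by (simp add: v_def i'_def j'_def)
    ultimately have ij': "i' = j'" using nth_eq_iff_index_eq[OF dv] assms(5) by simp
    moreover have "(i' + 1) mod m = i" if "i' = (i + m - 1) mod m" "i < m" for i i'
      using that assms(6) by (cases i) (auto simp: mod_Suc_eq)
    ultimately show "i = j" using ij i'_def j'_def by (metis lessThan_iff)
  qed
  moreover have "\<forall>i<m. {v i, v ((i + 1) mod m)} \<subseteq> E i"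
    using berge_walk_nth[OF walk] assms(5) v0 vS unfolding E_def
    by (metis empty_subsetI insert_subset)
  ultimately show ?thesis unfolding has_berge_cycle_def by blast
qed

section \<open>Paths of prescribed length in graphs of large minimum degree\<close>

text \<open>The members of \<open>Q\<close> label the edges \<open>p f\<close> of an ordinary graph, of which only the part on \<open>U\<close>
  matters: \<open>degree\<close> and \<open>connected\<close> speak of the subgraph induced by \<open>U\<close>.\<close>

locale pair_graph =
  fixes Q :: "'a set set" and p :: "'a set \<Rightarrow> 'a set" and U :: "'a set" and D :: nat
  assumes fin: "finite Q" "finite U"
    and card_p: "\<And>f. f \<in> Q \<Longrightarrow> card (p f) = 2"
    and inj_p: "inj_on p Q"
    and degree: "\<And>u. u \<in> U \<Longrightarrow> D \<le> card {f \<in> Q. u \<in> p f \<and> p f \<subseteq> U}"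
    and connected: "\<And>A. A \<subseteq> U \<Longrightarrow> A \<noteq> {} \<Longrightarrow> A \<noteq> U \<Longrightarrow>
      \<exists>f\<in>Q. \<exists>u\<in>A. \<exists>v\<in>U - A. p f = {u, v}"
    and D_ge: "3 \<le> D" and U_ne: "U \<noteq> {}"
begin

definition nbrs :: "'a \<Rightarrow> 'a set" where
  "nbrs v = {x \<in> U. \<exists>f\<in>Q. p f = {v, x}}"

lemma nbrs_sym: "v \<in> U \<Longrightarrow> x \<in> nbrs v \<Longrightarrow> v \<in> nbrs x"
  by (auto simp: nbrs_def insert_commute)

lemma finite_nbrs: "finite (nbrs v)"
  using fin by (simp add: nbrs_def)

lemma not_self_nbr: "v \<notin> nbrs v"
  using card_p by (fastforce simp: nbrs_def)

lemma card_nbrs: assumes v: "v \<in> U" shows "D \<le> card (nbrs v)"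
proof -
  let ?S = "{f \<in> Q. v \<in> p f \<and> p f \<subseteq> U}"
  have "p ` ?S \<subseteq> (\<lambda>x. {v, x}) ` nbrs v"
  proof
    fix e assume "e \<in> p ` ?S"
    then obtain f where f: "f \<in> Q" "v \<in> p f" "p f \<subseteq> U" "e = p f" by blast
    then obtain x where "p f = {v, x}" using card_p[of f]
      by (metis card_2_iff insertE insert_commute singletonD)
    then show "e \<in> (\<lambda>x. {v, x}) ` nbrs v" using f by (auto simp: nbrs_def)
  qed
  moreover have "card (p ` ?S) = card ?S"
    by (rule card_image) (use inj_p in \<open>auto simp: inj_on_def\<close>)
  moreover have "card (p ` ?S) \<le> card ((\<lambda>x. {v, x}) ` nbrs v)"
    by (rule card_mono) (use finite_nbrs calculation(1) in auto)
  moreover have "card ((\<lambda>x. {v, x}) ` nbrs v) \<le> card (nbrs v)"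
    by (rule card_image_le[OF finite_nbrs])
  ultimately have "card ?S \<le> card (nbrs v)" by linarith
  then show ?thesis using degree[OF v] by simp
qed

text \<open>The list format is that of \<open>berge_walk\<close>: an edge is recorded by its label
  in \<open>Q\<close>, so a path turns into a Berge walk without relabelling.\<close>

fun path :: "'a \<Rightarrow> ('a set \<times> 'a) list \<Rightarrow> 'a \<Rightarrow> bool" where
  "path u [] w \<longleftrightarrow> u = w"
| "path u ((e, v) # xs) w \<longleftrightarrow>
    e \<in> Q \<and> p e = {u, v} \<and> v \<in> U \<and> u \<notin> insert v (snd ` set xs) \<and> path v xs w"

lemma path_simple:
  "path u xs w \<Longrightarrow> distinct (u # map snd xs) \<and> snd ` set xs \<subseteq> U \<and> fst ` set xs \<subseteq> Q \<and>
    w \<in> insert u (snd ` set xs) \<and>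
    (\<forall>e\<in>fst ` set xs. p e \<subseteq> insert u (snd ` set xs)) \<and> distinct (map fst xs)"
proof (induction u xs w rule: path.induct)
  case (2 u e v xs w)
  then show ?case by auto
qed simp

lemma path_berge_walk:
  assumes "\<And>f. f \<in> Q \<Longrightarrow> p f \<subseteq> f"
  shows "path u xs w \<Longrightarrow> berge_walk u xs w"
proof (induction u xs w rule: path.induct)
  case (2 u e v xs w)
  then have "{u, v} \<subseteq> e" using assms[of e] by auto
  then show ?case using 2 by auto
qed simp

lemma path_prepend:
  assumes "path v xs w" "x \<in> nbrs v" "v \<in> U" "x \<notin> snd ` set xs"
  obtains e where "path x ((e, v) # xs) w"
proof -
  obtain e where e: "e \<in> Q" "p e = {x, v}"
    using assms(2) by (auto simp: nbrs_def insert_commute)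
  then have "path x ((e, v) # xs) w" using assms card_p[OF e(1)] by auto
  then show thesis by (rule that)
qed

text \<open>Each step leaves for a neighbour outside \<open>X\<close> and adds the vertex just left
  to \<open>X\<close>. A vertex is not its own neighbour, so the current one need not be counted;
  this makes \<open>r = D\<close> possible when \<open>X\<close> is empty.\<close>

lemma greedy_path:
  assumes "v \<in> U" "finite X" "r + card X \<le> D" "v \<notin> X"
  shows "\<exists>xs w. path v xs w \<and> length xs = r \<and> snd ` set xs \<inter> X = {}"
  using assms
proof (induction r arbitrary: v X)
  case 0
  then show ?case by (intro exI[of _ "[]"]) auto
next
  case (Suc r)
  have "card X < card (nbrs v)" using card_nbrs[OF Suc.prems(1)] Suc.prems(3) by simp
  then obtain x where x: "x \<in> nbrs v" "x \<notin> X"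
    using Suc.prems(2) by (meson card_mono leD subsetI)
  have xU: "x \<in> U" and xv: "x \<noteq> v" using x not_self_nbr by (auto simp: nbrs_def)
  have "r + card (insert v X) \<le> D" using Suc.prems by simp
  then obtain xs w where xs: "path x xs w" "length xs = r" "snd ` set xs \<inter> insert v X = {}"
    using Suc.IH[of x "insert v X"] xU xv x(2) Suc.prems(2) by auto
  obtain e where "path v ((e, x) # xs) w"
    using path_prepend[OF xs(1) nbrs_sym[OF Suc.prems(1) x(1)] xU] xs(3) by auto
  then show ?case using xs x by (intro exI[of _ "(e, x) # xs"] exI[of _ w]) auto
qed

text \<open>If no path of length \<open>m\<close> joins the two colours, then all neighbours of a vertex \<open>v\<close> have the
  same colour, since a path of length \<open>m - 1\<close> from \<open>v\<close> extends backwards to any of them. So the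
  vertices with only oppositely coloured neighbours form a union of components.\<close>

lemma bichromatic_path:
  fixes col :: "'a \<Rightarrow> bool"
  assumes "u\<^sub>1 \<in> U" "u\<^sub>2 \<in> U" "col u\<^sub>1 \<noteq> col u\<^sub>2" and m: "1 \<le> m" "m < D"
    and no: "\<And>u xs w. u \<in> U \<Longrightarrow> w \<in> U \<Longrightarrow> path u xs w \<Longrightarrow> length xs = m \<Longrightarrow> col u = col w"
  shows "\<forall>v\<in>U. \<forall>x\<in>nbrs v. col x \<noteq> col v"
proof -
  have mono: "col x = col y" if v: "v \<in> U" and x: "x \<in> nbrs v" and y: "y \<in> nbrs v" for v x y
  proof -
    have "card {x, y} \<le> 2" by (simp add: card_insert_if)
    then have "m - 1 + card {x, y} \<le> D" using m by linarith
    moreover have "v \<notin> {x, y}" using x y not_self_nbr by auto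
    ultimately obtain xs w where xs: "path v xs w" "length xs = m - 1"
        "snd ` set xs \<inter> {x, y} = {}"
      using greedy_path[of v "{x, y}" "m - 1"] v by auto
    have wU: "w \<in> U" using path_simple[OF xs(1)] v by auto
    have "col t = col w" if t: "t \<in> {x, y}" for t
    proof -
      have tn: "t \<in> nbrs v" "t \<notin> snd ` set xs" using t x y xs(3) by auto
      then obtain e where "path t ((e, v) # xs) w" using path_prepend[OF xs(1)] v by metis
      moreover have "length ((e, v) # xs) = m" "t \<in> U" using tn xs(2) m by (auto simp: nbrs_def)
      ultimately show ?thesis using no wU by blast
    qed
    then show ?thesis by simp
  qed
  define S where "S = {v \<in> U. \<forall>x\<in>nbrs v. col x \<noteq> col v}"
  have inS: "v \<in> S" if "v \<in> U" "x \<in> nbrs v" "col x \<noteq> col v" for v x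
    using that mono unfolding S_def by blast
  have edge: "y \<in> nbrs x" if "f \<in> Q" "p f = {x, y}" "y \<in> U" for f x y
    using that by (auto simp: nbrs_def)
  have "{u \<in> U. col u} \<noteq> {}" "{u \<in> U. col u} \<noteq> U" using assms(1-3) by auto
  then obtain f a b where ab: "f \<in> Q" "a \<in> U" "col a" "b \<in> U" "\<not> col b" "p f = {a, b}"
    using connected[of "{u \<in> U. col u}"] by blast
  then have "a \<in> S" using inS edge by metis
  have "S = U"
  proof (rule ccontr)
    assume "S \<noteq> U"
    moreover have "S \<subseteq> U" "S \<noteq> {}" using \<open>a \<in> S\<close> by (auto simp: S_def)
    ultimately obtain f s t where st: "f \<in> Q" "s \<in> S" "t \<in> U - S" "p f = {s, t}"
      using connected[of S] by blast
    then have "t \<in> nbrs s" using edge by blast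
    then have "col t \<noteq> col s" "s \<in> nbrs t" using st nbrs_sym by (auto simp: S_def)
    then show False using inS st by auto
  qed
  then show ?thesis unfolding S_def by blast
qed

lemma path_alternates:
  fixes col :: "'a \<Rightarrow> bool"
  assumes "\<forall>v\<in>U. \<forall>x\<in>nbrs v. col x \<noteq> col v"
  shows "path u xs w \<Longrightarrow> u \<in> U \<Longrightarrow> (col w = col u) = even (length xs)"
proof (induction u xs w rule: path.induct)
  case (2 u e v xs w)
  then have "v \<in> nbrs u" by (auto simp: nbrs_def)
  then have "col v \<noteq> col u" using assms 2 by blast
  moreover have "(col w = col v) = even (length xs)" using 2 by auto
  ultimately show ?case by (cases "col u"; cases "col v"; cases "col w") auto
qed simp

end

section \<open>Ancestors and walks in the breadth-first tree\<close>

text \<open>\<open>hp y\<close> is the tree edge through which \<open>y\<close> is reached from \<open>par y\<close>; both are junk at the root.\<close>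

locale bfs_tree =
  fixes H :: "'a set set" and R :: "'a set" and lev :: "'a \<Rightarrow> nat"
    and par :: "'a \<Rightarrow> 'a" and hp :: "'a \<Rightarrow> 'a set"
  assumes finite_R: "finite R"
    and uniform: "uniform3_on R H" and linear: "linear_hg H"
    and lev_edge: "\<And>f u v. f \<in> H \<Longrightarrow> u \<in> f \<Longrightarrow> v \<in> f \<Longrightarrow> lev v \<le> Suc (lev u)"
    and root: "\<And>u v. u \<in> R \<Longrightarrow> v \<in> R \<Longrightarrow> lev u = 0 \<Longrightarrow> lev v = 0 \<Longrightarrow> u = v"
    and parent: "\<And>y. y \<in> R \<Longrightarrow> 0 < lev y \<Longrightarrow>
      hp y \<in> H \<and> y \<in> hp y \<and> par y \<in> hp y \<and> Suc (lev (par y)) = lev y"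
begin

definition tree_edges :: "'a set set" where
  "tree_edges = hp ` {y \<in> R. 0 < lev y}"

definition level :: "nat \<Rightarrow> 'a set" where
  "level i = {y \<in> R. lev y = i}"

text \<open>Ancestors are indexed by their level rather than by the distance from \<open>u\<close>,
  so that vertices on different levels can be compared. The meaning is the intended one for
  \<open>l \<le> lev u\<close>.\<close>

definition anc :: "nat \<Rightarrow> 'a \<Rightarrow> 'a" where
  "anc l u = (par ^^ (lev u - l)) u"

lemma edge_sub: "f \<in> H \<Longrightarrow> f \<subseteq> R" and edge_card: "f \<in> H \<Longrightarrow> card f = 3"
  using uniform by (auto simp: uniform3_on_def)

lemma finite_H: "finite H"
  by (rule finite_subset[of H "Pow R"]) (use edge_sub finite_R in auto)

lemma finite_edge: "f \<in> H \<Longrightarrow> finite f"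
  using edge_card by (metis card.infinite zero_neq_numeral)

lemma finite_level: "finite (level i)"
  using finite_R by (simp add: level_def)

lemma linear_eq:
  assumes "f \<in> H" "g \<in> H" "a \<in> f" "b \<in> f" "a \<in> g" "b \<in> g" "a \<noteq> b"
  shows "f = g"
proof (rule ccontr)
  assume "f \<noteq> g"
  then have "card (f \<inter> g) \<le> 1" using linear assms unfolding linear_hg_def by blast
  moreover have "card {a, b} \<le> card (f \<inter> g)"
    by (rule card_mono) (use assms finite_edge in auto)
  ultimately show False using assms(7) by simp
qed

lemma par_in_R: "y \<in> R \<Longrightarrow> 0 < lev y \<Longrightarrow> par y \<in> R"
  using parent edge_sub by blast

lemma anc_self: "anc (lev u) u = u"
  by (simp add: anc_def)

lemma anc_par: "u \<in> R \<Longrightarrow> l < lev u \<Longrightarrow> anc l u = anc l (par u)"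
proof -
  assume u: "u \<in> R" "l < lev u"
  then have "Suc (lev (par u)) = lev u" using parent by auto
  then have "lev u - l = Suc (lev (par u) - l)" using u by simp
  then show ?thesis by (simp add: anc_def funpow_swap1)
qed

lemma anc_props: "u \<in> R \<Longrightarrow> l \<le> lev u \<Longrightarrow> anc l u \<in> R \<and> lev (anc l u) = l"
proof (induction "lev u - l" arbitrary: u)
  case 0
  then have "l = lev u" by simp
  then show ?case using 0 anc_self by simp
next
  case (Suc n)
  then have l: "l < lev u" by simp
  then have p: "Suc (lev (par u)) = lev u" "par u \<in> R"
    using parent[of u] par_in_R[of u] Suc.prems by auto
  then show ?case using Suc.hyps(1)[of "par u"] Suc.hyps(2) anc_par[OF Suc.prems(1) l] l by auto
qed

lemma par_anc: "u \<in> R \<Longrightarrow> l < lev u \<Longrightarrow> par (anc (Suc l) u) = anc l u"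
proof -
  assume "u \<in> R" "l < lev u"
  then have "lev u - l = Suc (lev u - Suc l)" by simp
  then show ?thesis by (simp add: anc_def)
qed

lemma anc_eq_mono:
  assumes "u \<in> R" "w \<in> R" "l \<le> l'" "l' \<le> lev u" "l' \<le> lev w" "anc l' u = anc l' w"
  shows "anc l u = anc l w"
  using assms(3)
proof (induction rule: inc_induct)
  case base
  then show ?case by (rule assms(6))
next
  case (step n)
  then show ?case using par_anc[of u n] par_anc[of w n] assms by simp
qed

lemma anc_root: "u \<in> R \<Longrightarrow> w \<in> R \<Longrightarrow> anc 0 u = anc 0 w"
  using root anc_props by simp

lemma lev_hp:
  assumes "y \<in> R" "0 < lev y" "v \<in> hp y"
  shows "lev v \<le> lev y" "lev y \<le> Suc (lev v)"
  using parent[OF assms(1,2)] lev_edge[of "hp y" "par y" v] lev_edge[of "hp y" v y] assms(3)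
  by auto

lemma hp_eq_lev:
  assumes "y \<in> R" "0 < lev y" "y' \<in> R" "0 < lev y'" "hp y = hp y'"
  shows "lev y = lev y'"
  using lev_hp(1)[OF assms(1,2), of y'] lev_hp(1)[OF assms(3,4), of y]
    parent[OF assms(1,2)] parent[OF assms(3,4)] assms(5) by (intro le_antisym) simp_all

text \<open>Vertices sharing a tree edge have equal level, and their parent, one level lower,
  occupies one of the three places in it. So a tree edge serves at most two children.\<close>

lemma hp_fibre:
  assumes "a \<in> R" "b \<in> R" "c \<in> R" "0 < lev a" "0 < lev b" "0 < lev c"
    and "hp a = hp b" "hp a = hp c" "a \<noteq> b" "a \<noteq> c"
  shows "b = c"
proof (rule ccontr)
  assume "b \<noteq> c"
  have l: "lev a = lev b" "lev a = lev c" using hp_eq_lev assms by auto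
  have P: "a \<in> hp a" "par a \<in> hp a" "b \<in> hp a" "c \<in> hp a" "Suc (lev (par a)) = lev a"
    using parent[OF assms(1,4)] parent[OF assms(2,5)] parent[OF assms(3,6)] assms(7,8) by auto
  then have "par a \<notin> {a, b, c}" using l by auto
  then have "card {par a, a, b, c} = 4" using \<open>b \<noteq> c\<close> assms by auto
  moreover have "card {par a, a, b, c} \<le> card (hp a)"
    by (rule card_mono) (use P finite_edge parent[OF assms(1,4)] in auto)
  ultimately show False using edge_card parent[OF assms(1,4)] by simp
qed

text \<open>Two children and two different parents would be four vertices of one triple.\<close>

lemma hp_eq_par:
  assumes "a \<in> R" "b \<in> R" "0 < lev a" "0 < lev b" "hp a = hp b"
  shows "par a = par b"
proof (cases "a = b")
  case False
  have l: "lev a = lev b" using hp_eq_lev assms by auto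
  have P: "a \<in> hp a" "par a \<in> hp a" "b \<in> hp a" "par b \<in> hp a"
      "Suc (lev (par a)) = lev a" "Suc (lev (par b)) = lev b"
    using parent[OF assms(1,3)] parent[OF assms(2,4)] assms(5) by auto
  show ?thesis
  proof (rule ccontr)
    assume "par a \<noteq> par b"
    moreover have "par a \<notin> {a, b}" "par b \<notin> {a, b}" using P l by auto
    ultimately have "card {par a, par b, a, b} = 4" using False by auto
    moreover have "card {par a, par b, a, b} \<le> card (hp a)"
      by (rule card_mono) (use P finite_edge parent[OF assms(1,3)] in auto)
    ultimately show False using edge_card parent[OF assms(1,3)] by simp
  qed
qed simp

lemma up_walk:
  assumes "u \<in> R" "a \<le> b" "1 \<le> a" "b \<le> Suc (lev u)"
  shows "berge_walk (anc (b - 1) u) (map (\<lambda>t. (hp (anc t u), anc (t - 1) u)) (rev [a..<b]))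
    (anc (a - 1) u)"
  using assms(2,4)
proof (induction rule: dec_induct)
  case (step b)
  then have "0 < b" "b \<le> lev u" using assms(3) by auto
  moreover have "anc b u \<in> R" "lev (anc b u) = b" using anc_props assms(1) calculation by auto
  moreover have "par (anc b u) = anc (b - 1) u" using par_anc[OF assms(1), of "b - 1"] calculation by simp
  ultimately show ?case using step parent[of "anc b u"] by simp
qed simp

text \<open>The start \<open>z\<close> may be any vertex of the first tree edge, so the descent can
  begin at the common parent or at a sibling on the same edge.\<close>

lemma down_walk:
  assumes "w \<in> R" "a \<le> b" "1 \<le> a" "b \<le> lev w" "z \<in> hp (anc a w)"
  shows "berge_walk z (map (\<lambda>t. (hp (anc t w), anc t w)) [a..<Suc b]) (anc b w)"
  using assms(2,4)
proof (induction rule: dec_induct)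
  case base
  then show ?case using assms anc_props[of w a] parent[of "anc a w"] by simp
next
  case (step b)
  then have "b < lev w" by simp
  moreover have "anc (Suc b) w \<in> R" "lev (anc (Suc b) w) = Suc b"
    using anc_props assms(1) calculation by auto
  moreover have "par (anc (Suc b) w) = anc b w" using par_anc[OF assms(1)] calculation by simp
  ultimately have A: "berge_walk (anc b w) [(hp (anc (Suc b) w), anc (Suc b) w)] (anc (Suc b) w)"
    using parent[of "anc (Suc b) w"] by auto
  have B: "berge_walk z (map (\<lambda>t. (hp (anc t w), anc t w)) [a..<Suc b]) (anc b w)"
    using step.IH step.prems by simp
  have "map (\<lambda>t. (hp (anc t w), anc t w)) [a..<Suc (Suc b)] =
      map (\<lambda>t. (hp (anc t w), anc t w)) [a..<Suc b] @ [(hp (anc (Suc b) w), anc (Suc b) w)]"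
    using step.hyps by simp
  then show ?case using berge_walk_trans[OF B A] by (simp only:)
qed

text \<open>Two distinct vertices at the branching level \<open>l\<close> may lie on the same tree edge, which then
  serves both of them; this is the case distinction in the length.\<close>

lemma tree_walk:
  assumes uw: "u \<in> R" "w \<in> R" and l: "0 < l" "l \<le> lev u" "l \<le> lev w"
    and ne: "anc l u \<noteq> anc l w" and eq: "anc (l - 1) u = anc (l - 1) w"
  obtains xs where "berge_walk u xs w" "distinct (map fst xs)" "distinct (map snd xs)"
    "fst ` set xs \<subseteq> tree_edges"
    "snd ` set xs \<subseteq> {anc t u | t. t < lev u} \<union> {anc t w | t. t \<le> lev w}"
    "length xs = (lev u - l) + (lev w - l) + (if hp (anc l u) = hp (anc l w) then 1 else 2)"
proof -
  \<comment> \<open>With a shared edge the ascent stops one step early, at \<open>anc l u\<close>;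
    the first edge of the descent then leads directly to \<open>anc l w\<close>.\<close>
  define a where "a = (if hp (anc l u) = hp (anc l w) then Suc l else l)"
  define up where "up = map (\<lambda>t. (hp (anc t u), anc (t - 1) u)) (rev [a..<Suc (lev u)])"
  define down where "down = map (\<lambda>t. (hp (anc t w), anc t w)) [l..<Suc (lev w)]"
  have a: "1 \<le> a" "a \<le> Suc (lev u)" "l \<le> a" using l by (auto simp: a_def)
  have ancu: "anc t u \<in> R" "lev (anc t u) = t" if "t \<le> lev u" for t
    using anc_props uw that by auto
  have ancw: "anc t w \<in> R" "lev (anc t w) = t" if "t \<le> lev w" for t
    using anc_props uw that by auto
  have walk_up: "berge_walk u up (anc (a - 1) u)"
    using up_walk[OF uw(1) a(2,1)] by (simp add: up_def anc_self)
  have "anc (a - 1) u \<in> hp (anc l w)"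
  proof (cases "hp (anc l u) = hp (anc l w)")
    case True
    then show ?thesis using parent[of "anc l u"] ancu[of l] l by (simp add: a_def)
  next
    case False
    have "par (anc l w) = anc (l - 1) w" using par_anc[OF uw(2), of "l - 1"] l by simp
    then show ?thesis using parent[of "anc l w"] ancw[of l] l False eq by (simp add: a_def)
  qed
  then have walk_down: "berge_walk (anc (a - 1) u) down w"
    using down_walk[OF uw(2) l(3), of "anc (a - 1) u"] l by (simp add: down_def anc_self)
  \<comment> \<open>Above the branching the two ancestor lines stay apart. A tree edge common to
    both would have children of equal level and the same parent, so it could only occur at level
    \<open>l\<close>, which \<open>a\<close> excludes from the ascent in that case.\<close>
  have differ: "anc t u \<noteq> anc t w" if "l \<le> t" "t \<le> lev u" "t \<le> lev w" for t
    using anc_eq_mono[OF uw, of l t] that ne by blast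
  have hp_differ: "hp (anc t u) \<noteq> hp (anc t' w)"
    if t: "a \<le> t" "t \<le> lev u" "l \<le> t'" "t' \<le> lev w" for t t'
  proof
    assume h: "hp (anc t u) = hp (anc t' w)"
    have t0: "0 < t" "0 < t'" using t a l by auto
    have F: "anc t u \<in> R" "0 < lev (anc t u)" "anc t' w \<in> R" "0 < lev (anc t' w)"
      using ancu[OF t(2)] ancw[OF t(4)] t0 by auto
    have tt: "t' = t" using hp_eq_lev[OF F h] ancu(2)[OF t(2)] ancw(2)[OF t(4)] by argo
    have "par (anc t u) = par (anc t' w)" by (rule hp_eq_par[OF F(1,3,2,4) h])
    then have pe: "anc (t - 1) u = anc (t - 1) w"
      using par_anc[OF uw(1), of "t - 1"] par_anc[OF uw(2), of "t - 1"] t t0 tt by simp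
    have tl: "t = l"
    proof (rule ccontr)
      assume "t \<noteq> l"
      then have "l \<le> t - 1" using t a by simp
      then show False using differ[of "t - 1"] pe t tt by simp
    qed
    have "hp (anc l u) = hp (anc l w)" using h unfolding tt tl .
    then have "a = Suc l" unfolding a_def by (rule if_P)
    then show False using t(1) tl by linarith
  qed
  show thesis
  proof (rule that[of "up @ down"])
    show "berge_walk u (up @ down) w" by (rule berge_walk_trans[OF walk_up walk_down])
    have inj1: "inj_on (\<lambda>t. hp (anc t u)) {a..lev u}"
    proof (rule inj_onI)
      fix s t assume st: "s \<in> {a..lev u}" "t \<in> {a..lev u}" "hp (anc s u) = hp (anc t u)"
      then have "s \<le> lev u" "t \<le> lev u" "0 < s" "0 < t" using a by auto
      note F = ancu[OF this(1)] ancu[OF this(2)] this(3,4)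
      have "lev (anc s u) = lev (anc t u)"
        by (rule hp_eq_lev[OF F(1) _ F(3) _ st(3)]) (simp_all only: F(2,4,5,6))
      then show "s = t" unfolding F(2,4) .
    qed
    have inj2: "inj_on (\<lambda>t. hp (anc t w)) {l..lev w}"
    proof (rule inj_onI)
      fix s t assume st: "s \<in> {l..lev w}" "t \<in> {l..lev w}" "hp (anc s w) = hp (anc t w)"
      then have "s \<le> lev w" "t \<le> lev w" "0 < s" "0 < t" using l by auto
      note F = ancw[OF this(1)] ancw[OF this(2)] this(3,4)
      have "lev (anc s w) = lev (anc t w)"
        by (rule hp_eq_lev[OF F(1) _ F(3) _ st(3)]) (simp_all only: F(2,4,5,6))
      then show "s = t" unfolding F(2,4) .
    qed
    have sets: "set [a..<Suc (lev u)] = {a..lev u}" "set [l..<Suc (lev w)] = {l..lev w}" by auto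
    have steps: "fst ` set up = (\<lambda>t. hp (anc t u)) ` {a..lev u}"
        "fst ` set down = (\<lambda>t. hp (anc t w)) ` {l..lev w}"
        "snd ` set up = (\<lambda>t. anc (t - 1) u) ` {a..lev u}"
        "snd ` set down = (\<lambda>t. anc t w) ` {l..lev w}"
      by (simp_all only: up_def down_def set_map set_rev sets image_image fst_conv snd_conv)
    have "distinct (map fst up)" "distinct (map fst down)"
      using inj1 inj2 by (simp_all only: up_def down_def map_map o_def fst_conv distinct_map
        distinct_rev distinct_upt set_rev sets simp_thms)
    moreover have "fst ` set up \<inter> fst ` set down = {}"
    proof (rule equals0I)
      fix e assume "e \<in> fst ` set up \<inter> fst ` set down"
      then obtain t t' where "t \<in> {a..lev u}" "t' \<in> {l..lev w}"
        "e = hp (anc t u)" "e = hp (anc t' w)" unfolding steps by blast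
      then show False using hp_differ[of t t'] by simp
    qed
    ultimately show "distinct (map fst (up @ down))" by simp
    have inj3: "inj_on (\<lambda>t. anc (t - 1) u) {a..lev u}"
    proof (rule inj_onI)
      fix s t assume st: "s \<in> {a..lev u}" "t \<in> {a..lev u}" "anc (s - 1) u = anc (t - 1) u"
      then have "s - 1 = t - 1" using ancu(2)[of "s - 1"] ancu(2)[of "t - 1"] by fastforce
      moreover have "1 \<le> s" "1 \<le> t" using st a by auto
      ultimately show "s = t" by linarith
    qed
    have inj4: "inj_on (\<lambda>t. anc t w) {l..lev w}"
      by (rule inj_on_inverseI[of _ lev]) (simp add: ancw(2))
    have "distinct (map snd up)" "distinct (map snd down)"
      using inj3 inj4 by (simp_all only: up_def down_def map_map o_def snd_conv distinct_map
        distinct_rev distinct_upt set_rev sets simp_thms)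
    moreover have "snd ` set up \<inter> snd ` set down = {}"
    proof -
      have "anc (t - 1) u \<noteq> anc t' w"
        if t: "a \<le> t" "t \<le> lev u" "l \<le> t'" "t' \<le> lev w" for t t'
      proof
        assume h: "anc (t - 1) u = anc t' w"
        have tt: "t - 1 = t'" using ancu(2)[of "t - 1"] ancw(2)[of t'] t h by fastforce
        have "t' \<le> lev u" using tt t(2) by linarith
        moreover have "anc t' u = anc t' w" using h unfolding tt .
        ultimately show False using differ t(3,4) by blast
      qed
      then show ?thesis unfolding steps disjoint_iff by fastforce
    qed
    ultimately show "distinct (map snd (up @ down))" by simp
    have "hp (anc t u) \<in> tree_edges" if "a \<le> t" "t \<le> lev u" for t
      using ancu[of t] that a by (simp add: tree_edges_def)
    moreover have "hp (anc t w) \<in> tree_edges" if "l \<le> t" "t \<le> lev w" for t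
      using ancw[of t] that l by (simp add: tree_edges_def)
    ultimately have "fst ` set up \<subseteq> tree_edges" "fst ` set down \<subseteq> tree_edges"
      unfolding steps by (intro image_subsetI; simp)+
    then show "fst ` set (up @ down) \<subseteq> tree_edges"
      by (simp only: set_append image_Un Un_subset_iff simp_thms)
    have "snd ` set up \<subseteq> {anc t u | t. t < lev u}"
      unfolding steps
    proof (rule image_subsetI)
      fix t assume "t \<in> {a..lev u}"
      then have "t - 1 < lev u" using a unfolding atLeastAtMost_iff by linarith
      then show "anc (t - 1) u \<in> {anc t u | t. t < lev u}" by blast
    qed
    moreover have "snd ` set down \<subseteq> {anc t w | t. t \<le> lev w}"
      unfolding steps
    proof (rule image_subsetI)
      fix t assume "t \<in> {l..lev w}"
      then have "t \<le> lev w" by simp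
      then show "anc t w \<in> {anc t w | t. t \<le> lev w}" by blast
    qed
    ultimately show "snd ` set (up @ down) \<subseteq> {anc t u | t. t < lev u} \<union> {anc t w | t. t \<le> lev w}"
      unfolding set_append image_Un by (rule Un_mono)
    show "length (up @ down) = (lev u - l) + (lev w - l) +
        (if hp (anc l u) = hp (anc l w) then 1 else 2)"
    proof -
      have len: "length (up @ down) = (Suc (lev u) - a) + (Suc (lev w) - l)"
        by (simp add: up_def down_def del: upt_Suc)
      show ?thesis
      proof (cases "hp (anc l u) = hp (anc l w)")
        case True
        then have "a = Suc l" unfolding a_def by (rule if_P)
        then show ?thesis unfolding len if_P[OF True] using l by linarith
      next
        case False
        then have "a = l" unfolding a_def by (rule if_not_P)
        then show ?thesis unfolding len if_not_P[OF False] using l by linarith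
      qed
    qed
  qed
qed

text \<open>The ascent from \<open>u\<close> lists only vertices below the level of
  \<open>u\<close>, where \<open>ys\<close> has none. Only the descent to \<open>w\<close> can meet
  \<open>ys\<close>, namely in the ancestor of \<open>w\<close> on that level; this is the vertex to
  be avoided.\<close>

lemma close_walk:
  assumes uw: "u \<in> R" "w \<in> R" and l: "0 < l" "l \<le> lev u" "l \<le> lev w"
    and ne: "anc l u \<noteq> anc l w" and eq: "anc (l - 1) u = anc (l - 1) w"
    and ys: "berge_walk w ys u" "distinct (map fst ys)" "distinct (map snd ys)"
    and edges: "fst ` set ys \<subseteq> H - tree_edges"
    and verts: "snd ` set ys \<subseteq> level (lev u)" "lev u \<le> lev w \<Longrightarrow> anc (lev u) w \<notin> snd ` set ys"
    and len: "length ys + (lev u - l) + (lev w - l) +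
      (if hp (anc l u) = hp (anc l w) then 1 else 2) = m"
  shows "has_berge_cycle H m"
proof -
  obtain xs where xs: "berge_walk u xs w" "distinct (map fst xs)" "distinct (map snd xs)"
    "fst ` set xs \<subseteq> tree_edges"
    "snd ` set xs \<subseteq> {anc t u | t. t < lev u} \<union> {anc t w | t. t \<le> lev w}"
    "length xs = (lev u - l) + (lev w - l) + (if hp (anc l u) = hp (anc l w) then 1 else 2)"
    using tree_walk[OF uw l ne eq] by blast
  show ?thesis
  proof (rule closed_berge_walk[OF berge_walk_trans[OF xs(1) ys(1)]])
    have "fst ` set xs \<inter> fst ` set ys = {}" using xs(4) edges by blast
    then show "distinct (map fst (xs @ ys))" using xs(2) ys(2) by simp
    have "snd ` set xs \<inter> snd ` set ys = {}"
    proof (rule equals0I)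
      fix v assume v: "v \<in> snd ` set xs \<inter> snd ` set ys"
      then have lv: "lev v = lev u" using verts(1) by (auto simp: level_def)
      consider t where "v = anc t u" "t < lev u" | t where "v = anc t w" "t \<le> lev w"
        using v xs(5) by blast
      then show False
      proof cases
        case 1
        then show False using anc_props[OF uw(1), of t] lv by simp
      next
        case 2
        then have "t = lev u" using anc_props[OF uw(2), of t] lv by simp
        then show False using 2 verts(2) v by blast
      qed
    qed
    then show "distinct (map snd (xs @ ys))" using xs(3) ys(3) by simp
    have "tree_edges \<subseteq> H" using parent by (auto simp: tree_edges_def)
    then show "fst ` set (xs @ ys) \<subseteq> H" using xs(4) edges by auto
    show "length (xs @ ys) = m" using xs(6) len by simp
    show "0 < m" unfolding len[symmetric] by simp
  qed
qed

end

section \<open>Berge cycles from a dense connected graph inside one level\<close>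

text \<open>The bound \<open>lev_Q\<close> controls the third vertex of a triple, which can lie
  outside level \<open>i\<close>. For \<open>i = k\<close> it excludes level \<open>k + 1\<close>,
  from which the way back through the tree could be too long.\<close>

locale level_graph = bfs_tree H R lev par hp + pair_graph Q p U D
  for H :: "'a set set" and R lev par hp and Q :: "'a set set" and p U D +
  fixes k i :: nat
  assumes k: "2 \<le> k" and D: "D = 2 * k - 1" and i: "i \<le> k"
    and Q_sub: "Q \<subseteq> H - tree_edges" and p_sub: "\<And>f. f \<in> Q \<Longrightarrow> p f \<subseteq> f"
    and U_sub: "U \<subseteq> level i" and lev_Q: "\<And>f v. f \<in> Q \<Longrightarrow> v \<in> f \<Longrightarrow> lev v \<le> k"
begin

lemma U_R: "u \<in> U \<Longrightarrow> u \<in> R" and U_lev: "u \<in> U \<Longrightarrow> lev u = i"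
  using U_sub by (auto simp: level_def)

lemma anc_i: "u \<in> U \<Longrightarrow> anc i u = u"
  using anc_self[of u] U_lev[of u] by simp

lemma path_end: "path u xs w \<Longrightarrow> xs \<noteq> [] \<Longrightarrow> w \<in> snd ` set xs \<and> w \<noteq> u"
proof (cases xs)
  case (Cons a ys)
  moreover assume "path u xs w"
  moreover obtain e v where "a = (e, v)" by (cases a)
  ultimately have "u \<notin> insert v (snd ` set ys)" "path v ys w" by auto
  then show ?thesis using path_simple[of v ys w] Cons \<open>a = (e, v)\<close> by auto
qed simp

text \<open>Both ends lie on level \<open>i\<close>, so the vertex of the descent to be avoided is
  \<open>w\<close> itself, which the path visits only as its start.\<close>

lemma close_path:
  assumes "u \<in> U" "w \<in> U" "path w ys u" and l: "0 < l" "l \<le> i"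
    and ne: "anc l u \<noteq> anc l w" and eq: "anc (l - 1) u = anc (l - 1) w"
    and len: "length ys + 2 * (i - l) + (if hp (anc l u) = hp (anc l w) then 1 else 2) = m"
  shows "has_berge_cycle H m"
proof (rule close_walk[OF U_R U_R l(1) _ _ ne eq path_berge_walk[OF p_sub assms(3)]])
  have ps: "distinct (w # map snd ys)" "snd ` set ys \<subseteq> U" "fst ` set ys \<subseteq> Q" "distinct (map fst ys)"
    using path_simple[OF assms(3)] by blast+
  show "distinct (map fst ys)" "distinct (map snd ys)" using ps by auto
  show "fst ` set ys \<subseteq> H - tree_edges" using ps(3) Q_sub by blast
  show "snd ` set ys \<subseteq> level (lev u)" using ps(2) U_sub U_lev assms(1) by simp
  show "anc (lev u) w \<notin> snd ` set ys" using ps(1) U_lev anc_i assms(1,2) by auto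
  show "length ys + (lev u - l) + (lev w - l) + (if hp (anc l u) = hp (anc l w) then 1 else 2) = m"
    using len U_lev assms(1,2) by simp
qed (use U_lev assms in auto)

text \<open>Branching at level \<open>i\<close> itself calls for a path of length \<open>D\<close>,
  just beyond the range of \<open>bichromatic_path\<close>. Instead it is used that at most two
  vertices of \<open>U\<close> share a tree edge, which makes it possible to extend a greedy path so
  that its ends have different ones.\<close>

lemma siblings_cycle:
  assumes "0 < i" and par_eq: "\<And>u w. u \<in> U \<Longrightarrow> w \<in> U \<Longrightarrow> anc (i - 1) u = anc (i - 1) w"
  shows "has_berge_cycle H (2 * k + 1)"
proof -
  have lpos: "0 < lev u" if "u \<in> U" for u using that U_lev assms(1) by simp
  have fibre: "b = c" if "a \<in> U" "b \<in> U" "c \<in> U" "hp a = hp b" "hp a = hp c" "a \<noteq> b" "a \<noteq> c" for a b c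
    by (rule hp_fibre[OF U_R U_R U_R lpos lpos lpos that(4-7)]) (rule that)+
  have close: ?thesis if "u \<in> U" "w \<in> U" "path w ys u" "length ys = D" "hp u \<noteq> hp w" for u w ys
  proof (rule close_path[OF that(1-3) assms(1) le_refl])
    show "anc i u \<noteq> anc i w" using that(5) unfolding anc_i[OF that(1)] anc_i[OF that(2)] by blast
    show "anc (i - 1) u = anc (i - 1) w" using par_eq that by blast
    show "length ys + 2 * (i - i) + (if hp (anc i u) = hp (anc i w) then 1 else 2) = 2 * k + 1"
      unfolding anc_i[OF that(1)] anc_i[OF that(2)] if_not_P[OF that(5)] using that(4) D k by simp
  qed
  show ?thesis
  \<comment> \<open>If two neighbours \<open>x\<close>, \<open>w\<close> of \<open>v\<close> share a
    tree edge, a path starting \<open>x\<close>, \<open>v\<close>, \<open>w\<close> has used up that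
    edge's two children, so its far end has another one.\<close>
  proof (cases "\<exists>v\<in>U. \<exists>x\<in>nbrs v. \<exists>w\<in>nbrs v. x \<noteq> w \<and> hp x = hp w")
    case True
    then obtain v x w where v: "v \<in> U" "x \<in> nbrs v" "w \<in> nbrs v" "x \<noteq> w" "hp x = hp w" by blast
    have xw: "x \<in> U" "w \<in> U" using v by (auto simp: nbrs_def)
    have vxw: "v \<noteq> x" "v \<noteq> w" using v not_self_nbr by auto
    have "D - 2 + card {x, v} \<le> D" using D_ge vxw by simp
    then obtain ys e where ys: "path w ys e" "length ys = D - 2" "snd ` set ys \<inter> {x, v} = {}"
      using greedy_path[of w "{x, v}" "D - 2"] xw v(4) vxw by auto
    obtain g where g: "path v ((g, w) # ys) e"
      using path_prepend[OF ys(1) nbrs_sym[OF v(1,3)] xw(2)] ys(3) by blast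
    have "x \<notin> snd ` set ((g, w) # ys)" using ys(3) v(4) by auto
    then obtain h where h: "path x ((h, v) # (g, w) # ys) e"
      using path_prepend[OF g v(2,1)] by blast
    have "ys \<noteq> []" using ys(2) D_ge by auto
    then have "e \<in> snd ` set ys" "e \<noteq> w" using path_end[OF ys(1)] by auto
    then have "e \<in> U" "e \<noteq> x" using path_simple[OF ys(1)] ys(3) by auto
    then have "hp e \<noteq> hp x" using fibre[of x w e] xw v(4,5) \<open>e \<noteq> w\<close> by metis
    then show ?thesis using close[OF \<open>e \<in> U\<close> xw(1) h] ys(2) D_ge by simp
  next
    case False
    obtain v where v: "v \<in> U" using U_ne by blast
    obtain ys w where ys: "path v ys w" "length ys = D - 1"
      using greedy_path[of v "{}" "D - 1"] v by auto
    have ps: "distinct (v # map snd ys)" "snd ` set ys \<subseteq> U" using path_simple[OF ys(1)] by blast+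
    have "ys \<noteq> []" using ys(2) D_ge by auto
    then have w: "w \<in> snd ` set ys" "w \<noteq> v" using path_end[OF ys(1)] by auto
    then have wU: "w \<in> U" using ps(2) by blast
    have cS: "card (snd ` set ys) = D - 1"
      using distinct_card[of "map snd ys"] ps(1) ys(2) by simp
    have "\<exists>x\<in>nbrs v - snd ` set ys. hp w \<noteq> hp x"
    proof (rule ccontr)
      assume neg: "\<not> ?thesis"
      \<comment> \<open>In this case the neighbours of \<open>v\<close> have distinct tree edges. At
        most one of them off the path shares the edge of \<open>w\<close>, and then \<open>w\<close>
        is no neighbour; this leaves room for only \<open>D - 1\<close> neighbours.\<close>
      have one: "x = x'" if "x \<in> nbrs v - snd ` set ys" "x' \<in> nbrs v - snd ` set ys" for x x'
        using that neg False v by (metis DiffD1)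
      have "\<not> nbrs v \<subseteq> snd ` set ys"
      proof
        assume "nbrs v \<subseteq> snd ` set ys"
        then have "card (nbrs v) \<le> D - 1" using cS card_mono[of "snd ` set ys" "nbrs v"] by simp
        then show False using card_nbrs[OF v] D_ge by simp
      qed
      then obtain x where x: "x \<in> nbrs v" "x \<notin> snd ` set ys" by blast
      then have "hp w = hp x" "x \<noteq> w" using neg w by auto
      then have "w \<notin> nbrs v" using False v x(1) by metis
      then have "nbrs v \<subseteq> insert x (snd ` set ys - {w})" using one x by blast
      then have "card (nbrs v) \<le> card (insert x (snd ` set ys - {w}))"
        by (intro card_mono) simp_all
      also have "\<dots> \<le> Suc (card (snd ` set ys - {w}))" by (simp add: card_insert_if)
      also have "\<dots> = D - 1" using cS w(1) D_ge by (simp add: card_Diff_singleton)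
      finally show False using card_nbrs[OF v] D_ge by simp
    qed
    then obtain x where x: "x \<in> nbrs v" "x \<notin> snd ` set ys" "hp w \<noteq> hp x" by blast
    then have xU: "x \<in> U" by (auto simp: nbrs_def)
    obtain g where g: "path x ((g, v) # ys) w" using path_prepend[OF ys(1) x(1) v x(2)] by blast
    then show ?thesis using close[OF wU xU g] ys(2) D_ge x(3) by simp
  qed
qed

text \<open>If no path of the odd length \<open>m\<close> joined the two colours, the colouring
  would be proper. But then any path of length \<open>m\<close>, which greedy extension provides,
  changes colour.\<close>

lemma several_branches_cycle:
  assumes l: "0 < l" "l < i" and below: "\<And>u w. u \<in> U \<Longrightarrow> w \<in> U \<Longrightarrow> anc (l - 1) u = anc (l - 1) w"
    and u: "u\<^sub>1 \<in> U" "u\<^sub>2 \<in> U" "hp (anc l u\<^sub>1) \<noteq> hp (anc l u\<^sub>2)"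
  shows "has_berge_cycle H (2 * k + 1)"
proof (rule ccontr)
  assume no: "\<not> ?thesis"
  define col where "col u = (hp (anc l u) = hp (anc l u\<^sub>1))" for u
  define m where "m = 2 * k - 1 - 2 * (i - l)"
  have m: "1 \<le> m" "m < D" "odd m" using l i D k by (auto simp: m_def)
  have mono: "col w = col u" if "w \<in> U" "u \<in> U" "path w xs u" "length xs = m" for w xs u
  proof (rule ccontr)
    assume "col w \<noteq> col u"
    then have ne: "hp (anc l u) \<noteq> hp (anc l w)" unfolding col_def by metis
    moreover have "anc l u \<noteq> anc l w" using ne by metis
    moreover have "length xs + 2 * (i - l) + (if hp (anc l u) = hp (anc l w) then 1 else 2) = 2 * k + 1"
      unfolding if_not_P[OF ne] using that(4) l i k by (simp add: m_def)
    ultimately show False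
      using close_path[OF that(2,1,3) l(1) less_imp_le[OF l(2)] _ below[OF that(2,1)]] no by blast
  qed
  have "col u\<^sub>1 \<noteq> col u\<^sub>2" using u(3) by (simp add: col_def)
  then have alt: "\<forall>v\<in>U. \<forall>x\<in>nbrs v. col x \<noteq> col v"
    using bichromatic_path[OF u(1,2) _ m(1,2)] mono by blast
  obtain xs w where xs: "path u\<^sub>1 xs w" "length xs = m"
    using greedy_path[of u\<^sub>1 "{}" m] u(1) m(2) by auto
  then have "w \<in> U" using path_simple[OF xs(1)] u(1) by auto
  then show False using path_alternates[OF alt xs(1) u(1)] mono[OF u(1) _ xs] xs(2) m(3) by simp
qed

text \<open>Here the two branches leave their common ancestor through one shared edge, so a path joining them
  closes to length \<open>2k + 1\<close> when it has the even length \<open>2k - 2(i - l)\<close>. No such path exists if the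
  branches colour the graph properly; the cycle then leaves an edge \<open>f\<close> of the graph through its
  third vertex \<open>c\<close>.\<close>

lemma single_branch_cycle:
  assumes l: "0 < l" "l < i" and below: "\<And>u w. u \<in> U \<Longrightarrow> w \<in> U \<Longrightarrow> anc (l - 1) u = anc (l - 1) w"
    and u: "u\<^sub>1 \<in> U" "u\<^sub>2 \<in> U" "anc l u\<^sub>1 \<noteq> anc l u\<^sub>2"
    and same: "\<And>u w. u \<in> U \<Longrightarrow> w \<in> U \<Longrightarrow> hp (anc l u) = hp (anc l w)"
  shows "has_berge_cycle H (2 * k + 1)"
proof (rule ccontr)
  assume no: "\<not> ?thesis"
  define col where "col u = (anc l u = anc l u\<^sub>1)" for u
  have ancl: "anc l u \<in> R" "lev (anc l u) = l" if "u \<in> U" for u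
    using anc_props[of u l] U_R U_lev that l by auto
  \<comment> \<open>The common tree edge has at most two children, so there are exactly two branches
    and \<open>col\<close> determines the ancestor at level \<open>l\<close>.\<close>
  have two: "anc l u = anc l w" if "u \<in> U" "w \<in> U" "col u = col w" for u w
  proof (cases "col u")
    case True
    then show ?thesis using that by (simp add: col_def)
  next
    case False
    have "anc l u = anc l u\<^sub>2" if "u \<in> U" "\<not> col u" for u
    proof (rule hp_fibre[of "anc l u\<^sub>1"])
      show "hp (anc l u\<^sub>1) = hp (anc l u)" "hp (anc l u\<^sub>1) = hp (anc l u\<^sub>2)"
        using same u that by blast+
      show "anc l u\<^sub>1 \<noteq> anc l u" using that by (simp add: col_def eq_commute)
    qed (use ancl u that l in auto)
    then show ?thesis using that False by metis
  qed
  define m where "m = 2 * k - 2 * (i - l)"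
  have m: "1 \<le> m" "m < D" using l i D k by (auto simp: m_def)
  have "col w = col u" if "w \<in> U" "u \<in> U" "path w xs u" "length xs = m" for w xs u
  proof (rule ccontr)
    assume "col w \<noteq> col u"
    then have "anc l u \<noteq> anc l w" by (auto simp: col_def)
    moreover have "length xs + 2 * (i - l) + (if hp (anc l u) = hp (anc l w) then 1 else 2) = 2 * k + 1"
      unfolding if_P[OF same[OF that(2,1)]] using that(4) l i k by (simp add: m_def)
    ultimately show False
      using close_path[OF that(2,1,3) l(1) less_imp_le[OF l(2)] _ below[OF that(2,1)]] no by blast
  qed
  moreover have "col u\<^sub>1 \<noteq> col u\<^sub>2" using u(3) by (auto simp: col_def)
  ultimately have alt: "\<forall>v\<in>U. \<forall>x\<in>nbrs v. col x \<noteq> col v"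
    using bichromatic_path[OF u(1,2) _ m] by blast
  have "nbrs u\<^sub>1 \<noteq> {}" using card_nbrs[OF u(1)] D_ge by auto
  then obtain f b where f: "f \<in> Q" "p f = {u\<^sub>1, b}" "b \<in> U" by (auto simp: nbrs_def)
  then have "b \<in> nbrs u\<^sub>1" by (auto simp: nbrs_def)
  then have colb: "col b \<noteq> col u\<^sub>1" using alt u(1) by blast
  then have "b \<noteq> u\<^sub>1" by blast
  have fH: "f \<in> H" "f \<notin> tree_edges" using f Q_sub by auto
  have "u\<^sub>1 \<in> f" "b \<in> f" using p_sub[OF f(1)] f(2) by auto
  obtain c where c: "c \<in> f" "c \<noteq> u\<^sub>1" "c \<noteq> b"
  proof -
    have "\<not> f \<subseteq> {u\<^sub>1, b}"
    proof
      assume "f \<subseteq> {u\<^sub>1, b}"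
      then have "card f \<le> card {u\<^sub>1, b}" by (intro card_mono) auto
      then show False using edge_card[OF fH(1)] \<open>b \<noteq> u\<^sub>1\<close> by simp
    qed
    then show thesis using that by blast
  qed
  have cR: "c \<in> R" using c edge_sub fH by blast
  have levc: "lev c \<le> k" "lev c \<le> Suc i" "i \<le> Suc (lev c)"
    using lev_Q[OF f(1) c(1)] lev_edge[OF fH(1) \<open>u\<^sub>1 \<in> f\<close> c(1)] lev_edge[OF fH(1) c(1) \<open>u\<^sub>1 \<in> f\<close>]
      U_lev u(1) by auto
  \<comment> \<open>At least one branch does not contain \<open>c\<close>. Its vertices have the
    same ancestors up to level \<open>l\<close>, so they all separate from \<open>c\<close> at the
    same level \<open>l'\<close> and in the same way \<open>h\<close>; the path length
    \<open>r\<close> is thus known before the end of the path is.\<close>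
  obtain s\<^sub>0 where s0: "s\<^sub>0 \<in> U" "anc l s\<^sub>0 \<noteq> anc l c" using u by metis
  define l' where "l' = (LEAST t. anc t s\<^sub>0 \<noteq> anc t c)"
  have l'ne: "anc l' s\<^sub>0 \<noteq> anc l' c" and l'l: "l' \<le> l"
    unfolding l'_def by (rule LeastI[of _ l], rule s0(2)) (rule Least_le, rule s0(2))
  have "0 < l'" using l'ne anc_root[OF U_R[OF s0(1)] cR] by (cases "l' = 0") auto
  then have l'eq: "anc (l' - 1) s\<^sub>0 = anc (l' - 1) c"
    using not_less_Least[of "l' - 1" "\<lambda>t. anc t s\<^sub>0 \<noteq> anc t c"] by (simp add: l'_def)
  define h :: nat where "h = (if hp (anc l' s\<^sub>0) = hp (anc l' c) then 1 else 2)"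
  have h: "1 \<le> h" "h \<le> 2" by (auto simp: h_def)
  define r where "r = 2 * k - (i - l') - (lev c - l') - h"
  \<comment> \<open>The truncated subtractions are exact: both levels are at most \<open>k\<close>
    and \<open>l'\<close> is positive, so the subtracted terms sum to at most
    \<open>2 * k\<close>.\<close>
  have r: "r + (i - l') + (lev c - l') + h = 2 * k"
    using h levc i \<open>0 < l'\<close> k l l'l by (simp add: r_def)
  \<comment> \<open>Since colours alternate, one of the two ends of \<open>f\<close> has the colour
    from which \<open>r\<close> steps lead into the branch of \<open>s\<^sub>0\<close>.\<close>
  obtain e e' where e: "p f = {e, e'}" "e \<noteq> e'" "e \<in> U" "e' \<in> U" "(col e = col s\<^sub>0) = even r"
      "{e, e'} = {u\<^sub>1, b}"
  proof (cases "(col u\<^sub>1 = col s\<^sub>0) = even r")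
    case True
    then show thesis by (rule that[OF f(2) \<open>b \<noteq> u\<^sub>1\<close>[symmetric] u(1) f(3) _ refl])
  next
    case False
    then have "(col b = col s\<^sub>0) = even r" using colb by auto
    then show thesis
      by (rule that[OF f(2)[unfolded insert_commute[of "u\<^sub>1"]] \<open>b \<noteq> u\<^sub>1\<close> f(3) u(1) _ insert_commute])
  qed
  have "e \<in> {u\<^sub>1, b}" unfolding e(6)[symmetric] by simp
  then have ef: "e \<in> f" "c \<noteq> e" using c \<open>u\<^sub>1 \<in> f\<close> \<open>b \<in> f\<close> by auto
  \<comment> \<open>Avoiding \<open>e'\<close> keeps \<open>f\<close> out of the path; avoiding the
    ancestor of \<open>c\<close> on level \<open>i\<close>, if there is one, keeps the path off the
    descent to \<open>c\<close>.\<close>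
  define X where "X = insert e' (if i \<le> lev c then {anc i c} else {})"
  have "card X \<le> (if i \<le> lev c then 2 else 1)" by (simp add: X_def card_insert_if)
  then have rX: "r + card X \<le> D" using r h l'l l levc D k by (auto split: if_splits)
  \<comment> \<open>If \<open>e\<close> were the parent of \<open>c\<close>, linearity would make
    \<open>f\<close> the tree edge of \<open>c\<close>.\<close>
  have "e \<noteq> anc i c" if ic: "i \<le> lev c"
  proof (cases "lev c = i")
    case True
    then show ?thesis using anc_self[of c] ef by auto
  next
    case False
    then have lc: "lev c = Suc i" using ic levc by simp
    then have "anc i c = par c" by (simp add: anc_def)
    moreover have "par c \<noteq> e"
    proof
      assume "par c = e"
      then have "hp c = f"
        using linear_eq[of "hp c" f c e] parent[OF cR] lc fH(1) c(1) ef by auto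
      then show False using fH(2) cR lc by (auto simp: tree_edges_def)
    qed
    ultimately show ?thesis by auto
  qed
  then have eX: "e \<notin> X" using e(2) by (simp add: X_def)
  have finX: "finite X" by (simp add: X_def)
  obtain P s where P: "path e P s" "length P = r" "snd ` set P \<inter> X = {}"
    using greedy_path[OF e(3) finX rX eX] by blast
  have ps: "distinct (e # map snd P)" "snd ` set P \<subseteq> U" "fst ` set P \<subseteq> Q" "s \<in> insert e (snd ` set P)"
      "\<forall>g\<in>fst ` set P. p g \<subseteq> insert e (snd ` set P)" "distinct (map fst P)"
    using path_simple[OF P(1)] by blast+
  have sU: "s \<in> U" using ps e(3) by blast
  have "col s = col s\<^sub>0" using path_alternates[OF alt P(1) e(3)] P(2) e(5) by metis
  then have "anc l s = anc l s\<^sub>0" using two sU s0(1) by blast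
  then have same_s: "anc t s = anc t s\<^sub>0" if "t \<le> l" for t
    using anc_eq_mono[of s "s\<^sub>0" t l] that U_R U_lev sU s0(1) l by auto
  have "has_berge_cycle H (2 * k + 1)"
  proof (rule close_walk[of s c l' "(f, e) # P"])
    show "anc l' s \<noteq> anc l' c" "anc (l' - 1) s = anc (l' - 1) c"
      using l'ne l'eq same_s l'l by auto
    show "berge_walk c ((f, e) # P) s" using path_berge_walk[OF p_sub P(1)] c ef by simp
    have "f \<notin> fst ` set P"
    proof
      assume "f \<in> fst ` set P"
      then have "e' \<in> insert e (snd ` set P)" using ps(5) e(1) by blast
      then show False using P(3) e(2) by (auto simp: X_def)
    qed
    then show "distinct (map fst ((f, e) # P))" using ps(6) by simp
    show "distinct (map snd ((f, e) # P))" using ps(1) by simp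
    show "fst ` set ((f, e) # P) \<subseteq> H - tree_edges" using ps(3) fH Q_sub by auto
    show "snd ` set ((f, e) # P) \<subseteq> level (lev s)" using ps(2) e(3) U_sub U_lev sU by auto
    show "anc (lev s) c \<notin> snd ` set ((f, e) # P)" if "lev s \<le> lev c"
    proof -
      have "anc i c \<in> X" using that U_lev sU by (simp add: X_def)
      then show ?thesis using P(3) eX U_lev sU by auto
    qed
    show "length ((f, e) # P) + (lev s - l') + (lev c - l') +
        (if hp (anc l' s) = hp (anc l' c) then 1 else 2) = 2 * k + 1"
      unfolding same_s[OF l'l] h_def[symmetric] U_lev[OF sU] using r P(2) by simp
    show "s \<in> R" "c \<in> R" "0 < l'" using U_R sU cR \<open>0 < l'\<close> by blast+
    show "l' \<le> lev s" "l' \<le> lev c" unfolding U_lev[OF sU] using l'l l levc by linarith+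
  qed
  then show False using no by blast
qed

text \<open>The case distinction is taken at the least level where the ancestors of \<open>U\<close>
  are not all equal; below it every pair agrees, so any two vertices that differ there branch
  exactly there.\<close>

lemma level_graph_cycle: "has_berge_cycle H (2 * k + 1)"
proof -
  define P where "P t \<longleftrightarrow> (\<exists>u\<in>U. \<exists>w\<in>U. anc t u \<noteq> anc t w)" for t
  obtain v where v: "v \<in> U" using U_ne by blast
  have "nbrs v \<noteq> {}" using card_nbrs[OF v] D_ge by auto
  then obtain x where x: "x \<in> nbrs v" by blast
  then have "x \<in> U" "x \<noteq> v" using not_self_nbr by (auto simp: nbrs_def)
  then have "P i" using v anc_i unfolding P_def by metis
  define l where "l = (LEAST t. P t)"
  have l: "P l" "l \<le> i" using LeastI[of P i] Least_le[of P i] \<open>P i\<close> by (auto simp: l_def)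
  have "\<not> P 0" using anc_root U_R unfolding P_def by blast
  then have l0: "0 < l" using l(1) by (cases "l = 0") auto
  then have "\<not> P (l - 1)" using not_less_Least[of "l - 1" P] by (simp add: l_def)
  then have below: "anc (l - 1) u = anc (l - 1) w" if "u \<in> U" "w \<in> U" for u w
    using that unfolding P_def by blast
  obtain u\<^sub>1 u\<^sub>2 where u: "u\<^sub>1 \<in> U" "u\<^sub>2 \<in> U" "anc l u\<^sub>1 \<noteq> anc l u\<^sub>2"
    using l(1) unfolding P_def by blast
  show ?thesis
  proof (cases "l = i")
    case True
    show ?thesis by (rule siblings_cycle[folded True, OF l0 below])
  next
    case False
    then have li: "l < i" using l by simp
    show ?thesis
    proof (cases "\<forall>u\<in>U. \<forall>w\<in>U. hp (anc l u) = hp (anc l w)")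
      case True
      then show ?thesis by (intro single_branch_cycle[OF l0 li below u]) blast+
    next
      case False
      then show ?thesis using several_branches_cycle[OF l0 li below] by blast
    qed
  qed
qed

end

section \<open>Few non-tree edges per level, and growth of the levels\<close>

text \<open>Among the nonempty sets inducing minimum degree \<open>D\<close>, one of least size is
  connected: a proper part that no edge leaves would inherit all its degrees.\<close>

lemma dense_pair_graph:
  assumes V: "finite V" and Q: "finite Q" and p2: "\<And>f. f \<in> Q \<Longrightarrow> card (p f) = 2"
    and pV: "\<And>f. f \<in> Q \<Longrightarrow> p f \<subseteq> V" and inj: "inj_on p Q" and D: "3 \<le> D"
    and dense: "(D - 1) * card V < card Q"
  shows "\<exists>U\<subseteq>V. pair_graph Q p U D"
proof -
  define good where "good U \<longleftrightarrow> U \<subseteq> V \<and> U \<noteq> {} \<and>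
    (\<forall>u\<in>U. D \<le> card {f \<in> Q. u \<in> p f \<and> p f \<subseteq> U})" for U
  have "real ((D - 1) * card V) < card Q" using dense by (simp only: of_nat_less_iff)
  then have "real (D - 1) * card V < card Q" by (simp only: of_nat_mult)
  moreover have "p f \<subseteq> V \<and> p f \<noteq> {}" if "f \<in> Q" for f
    using pV[OF that] p2[OF that] by fastforce
  ultimately obtain W where W: "W \<subseteq> V" "W \<noteq> {}"
    "\<And>u. u \<in> W \<Longrightarrow> real (D - 1) < card {f \<in> Q. u \<in> p f \<and> p f \<subseteq> W}"
    using dense_family_min_degree[OF V Q, of p "real (D - 1)"] by blast
  have "D \<le> card {f \<in> Q. u \<in> p f \<and> p f \<subseteq> W}" if "u \<in> W" for u
    using W(3)[OF that] by simp
  then have "good W" using W by (simp add: good_def)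
  then obtain U where U: "good U" and minU: "\<And>A. good A \<Longrightarrow> card U \<le> card A"
    using ex_has_least_nat[of good W card] by blast
  have fU: "finite U" using U V finite_subset by (auto simp: good_def)
  have "pair_graph Q p U D"
  proof
    show "finite Q" "finite U" "inj_on p Q" "3 \<le> D" by fact+
    show "card (p f) = 2" if "f \<in> Q" for f using p2 that .
    show "D \<le> card {f \<in> Q. u \<in> p f \<and> p f \<subseteq> U}" if "u \<in> U" for u
      using U that by (simp add: good_def)
    show "U \<noteq> {}" using U by (simp add: good_def)
    show "\<exists>f\<in>Q. \<exists>u\<in>A. \<exists>v\<in>U - A. p f = {u, v}" if A: "A \<subseteq> U" "A \<noteq> {}" "A \<noteq> U" for A
    proof (rule ccontr)
      assume neg: "\<not> ?thesis"
      have "D \<le> card {f \<in> Q. u \<in> p f \<and> p f \<subseteq> A}" if u: "u \<in> A" for u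
      proof -
        have "{f \<in> Q. u \<in> p f \<and> p f \<subseteq> U} \<subseteq> {f \<in> Q. u \<in> p f \<and> p f \<subseteq> A}"
        proof
          fix f assume "f \<in> {f \<in> Q. u \<in> p f \<and> p f \<subseteq> U}"
          then have f: "f \<in> Q" "u \<in> p f" "p f \<subseteq> U" by auto
          obtain v where "p f = {u, v}" using p2[OF f(1)] f(2)
            by (auto simp: card_2_iff doubleton_eq_iff)
          moreover have "v \<in> A" using neg f u calculation by blast
          ultimately show "f \<in> {f \<in> Q. u \<in> p f \<and> p f \<subseteq> A}" using f u by simp
        qed
        then have "card {f \<in> Q. u \<in> p f \<and> p f \<subseteq> U} \<le> card {f \<in> Q. u \<in> p f \<and> p f \<subseteq> A}"
          using Q by (intro card_mono) auto
        moreover have "D \<le> card {f \<in> Q. u \<in> p f \<and> p f \<subseteq> U}"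
          using U u A(1) by (auto simp: good_def)
        ultimately show ?thesis by linarith
      qed
      then have "good A" using A U by (auto simp: good_def)
      moreover have "card A < card U" using A fU by (intro psubset_card_mono) auto
      ultimately show False using minU by fastforce
    qed
  qed
  then show ?thesis using U by (auto simp: good_def)
qed

context bfs_tree
begin

definition thick :: "nat \<Rightarrow> nat \<Rightarrow> 'a set set" where
  "thick k i = {f \<in> H. f \<notin> tree_edges \<and> 2 \<le> card (f \<inter> level i) \<and> (\<forall>v\<in>f. lev v \<le> k)}"

lemma card_thick:
  assumes free: "\<not> has_berge_cycle H (2 * k + 1)" and k: "2 \<le> k" and i: "i \<le> k"
  shows "card (thick k i) \<le> (2 * k - 2) * card (level i)"
proof (rule ccontr)
  assume "\<not> ?thesis"
  then have dense: "(2 * k - 1 - 1) * card (level i) < card (thick k i)"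
    by (simp only: diff_diff_left one_add_one not_le)
  define p where "p f = (SOME P. P \<subseteq> f \<inter> level i \<and> card P = 2)" for f
  have p: "p f \<subseteq> f \<inter> level i \<and> card (p f) = 2" if "f \<in> thick k i" for f
  proof -
    have "2 \<le> card (f \<inter> level i)" using that by (simp add: thick_def)
    then obtain P where "P \<subseteq> f \<inter> level i" "card P = 2"
      by (rule obtain_subset_with_card_n)
    then have "P \<subseteq> f \<inter> level i \<and> card P = 2" by (rule conjI)
    then show ?thesis unfolding p_def by (rule someI)
  qed
  \<comment> \<open>Two vertices determine their triple by linearity, so choosing pairs loses no
    edges in the count.\<close>
  have inj: "inj_on p (thick k i)"
  proof (rule inj_onI)
    fix f g assume fg: "f \<in> thick k i" "g \<in> thick k i" "p f = p g"
    obtain a b where ab: "p f = {a, b}" "a \<noteq> b" using p[OF fg(1)] by (auto simp: card_2_iff)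
    have "{a, b} \<subseteq> f" "{a, b} \<subseteq> g" using p[OF fg(1)] p[OF fg(2)] fg(3) ab(1) by auto
    then show "f = g" using linear_eq[of f g a b] fg(1,2) ab(2) by (simp add: thick_def)
  qed
  have fin: "finite (thick k i)" using finite_H by (simp add: thick_def)
  have "3 \<le> 2 * k - 1" using k by linarith
  then have "\<exists>U\<subseteq>level i. pair_graph (thick k i) p U (2 * k - 1)"
    using p by (intro dense_pair_graph[OF finite_level fin _ _ inj _ dense]) blast+
  then obtain U where U: "U \<subseteq> level i" "pair_graph (thick k i) p U (2 * k - 1)" by blast
  interpret pair_graph "thick k i" p U "2 * k - 1" by (rule U(2))
  interpret level_graph H R lev par hp "thick k i" p U "2 * k - 1" k i
    by unfold_locales (use k i p U(1) in \<open>auto simp: thick_def\<close>)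
  show False using level_graph_cycle free by blast
qed

text \<open>A tree edge has child and parent on different levels, so at most two of its vertices lie
  on level \<open>i\<close>. If a non-tree edge has a single vertex there, its other two are on
  adjacent levels that differ by at most one, hence on the same level, and the edge is thick for
  that level.\<close>

lemma edge_level_bound:
  assumes f: "f \<in> H" and i: "i < k"
  shows "card (f \<inter> level i) \<le> 3 * of_bool (f \<in> thick k i) + of_bool (f \<in> thick k (i - 1))
    + of_bool (f \<in> thick k (Suc i)) + 2 * of_bool (f \<in> hp ` level i)
    + 2 * of_bool (f \<in> hp ` level (Suc i))"
proof (cases "f \<inter> level i = {}")
  case False
  then obtain v where v: "v \<in> f" "lev v = i" by (auto simp: level_def)
  have fR: "f \<subseteq> R" using edge_sub f .
  have ff: "finite f" and c3: "card f = 3" using finite_edge edge_card f by auto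
  have lev_k: "\<forall>u\<in>f. lev u \<le> k" using lev_edge[OF f v(1)] v(2) i by fastforce
  show ?thesis
  proof (cases "f \<in> tree_edges")
    case True
    then obtain y where y: "y \<in> R" "0 < lev y" "f = hp y" by (auto simp: tree_edges_def)
    then have P: "y \<in> f" "par y \<in> f" "Suc (lev (par y)) = lev y" using parent by auto
    have "lev y = i \<or> lev y = Suc i" using lev_hp[of y v] y v by auto
    then have "f \<in> hp ` level i \<or> f \<in> hp ` level (Suc i)" using y by (auto simp: level_def)
    moreover have "y \<notin> level i \<or> par y \<notin> level i" using P(3) by (auto simp: level_def)
    then have "f \<inter> level i \<subset> f" using P(1,2) by blast
    then have "card (f \<inter> level i) < 3" using psubset_card_mono[OF ff] c3 by metis
    ultimately show ?thesis by auto
  next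
    case nontree: False
    have "card (f \<inter> level i) \<le> 3" using card_mono[OF ff, of "f \<inter> level i"] c3 by simp
    show ?thesis
    proof (cases "2 \<le> card (f \<inter> level i)")
      case True
      then have "f \<in> thick k i" using f nontree lev_k by (simp add: thick_def)
      then show ?thesis using \<open>card (f \<inter> level i) \<le> 3\<close> by simp
    next
      case False
      moreover have "f \<inter> level i \<noteq> {}" by fact
      ultimately have c1: "card (f \<inter> level i) = 1" using ff
        by (metis One_nat_def Suc_1 card_0_eq finite_Int le_SucE not_less_eq_eq le0 le_zero_eq)
      then obtain w where "f \<inter> level i = {w}" by (rule card_1_singletonE)
      moreover have "v \<in> f \<inter> level i" using v fR by (auto simp: level_def)
      ultimately have "f \<inter> level i = {v}" by simp
      then have other: "lev u \<noteq> i" if "u \<in> f" "u \<noteq> v" for u using that fR by (auto simp: level_def)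
      have "card (f - {v}) = 2" using c3 ff v(1) by simp
      then obtain a b where ab: "f - {v} = {a, b}" "a \<noteq> b" by (auto simp: card_2_iff)
      then have abf: "a \<in> f" "b \<in> f" "a \<noteq> v" "b \<noteq> v" by auto
      have "lev a = lev b" "lev a = i - 1 \<or> lev a = Suc i"
        using other[OF abf(1,3)] other[OF abf(2,4)] lev_edge[OF f v(1) abf(1)]
          lev_edge[OF f abf(1) v(1)] lev_edge[OF f v(1) abf(2)] lev_edge[OF f abf(2) v(1)]
          lev_edge[OF f abf(1,2)] lev_edge[OF f abf(2,1)] v(2) by auto
      moreover have "2 \<le> card (f \<inter> level (lev a))" if "lev a = lev b"
      proof -
        have "{a, b} \<subseteq> f \<inter> level (lev a)" using abf that fR by (auto simp: level_def)
        then have "card {a, b} \<le> card (f \<inter> level (lev a))" using ff by (intro card_mono) auto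
        then show ?thesis using ab(2) by simp
      qed
      ultimately have "f \<in> thick k (i - 1) \<or> f \<in> thick k (Suc i)"
        using f nontree lev_k unfolding thick_def by auto
      then show ?thesis using c1 by auto
    qed
  qed
qed simp

lemma degree_count:
  assumes i: "i < k"
  shows "(\<Sum>v\<in>level i. card {f \<in> H. v \<in> f}) \<le> 3 * card (thick k i) + card (thick k (i - 1))
    + card (thick k (Suc i)) + 2 * card (level i) + 2 * card (level (Suc i))"
proof -
  have ind: "(\<Sum>f\<in>H. of_bool (f \<in> S)) = card (H \<inter> S)" for S :: "'a set set"
    using finite_H by (simp add: of_bool_def sum.If_cases)
  have sub: "H \<inter> thick k j = thick k j" for j by (auto simp: thick_def)
  have img: "card (H \<inter> hp ` level j) \<le> card (level j)" for j
    using finite_level by (meson card_image_le card_mono finite_imageI inf_le2 le_trans)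
  have "(\<Sum>v\<in>level i. card {f \<in> H. v \<in> f}) = (\<Sum>f\<in>H. card {v \<in> level i. v \<in> f})"
    by (rule sum_multicount_gen) (simp_all add: finite_H finite_level)
  also have "\<dots> = (\<Sum>f\<in>H. card (f \<inter> level i))" by (intro sum.cong arg_cong[of _ _ card]) auto
  also have "\<dots> \<le> (\<Sum>f\<in>H. 3 * of_bool (f \<in> thick k i) + of_bool (f \<in> thick k (i - 1))
      + of_bool (f \<in> thick k (Suc i)) + 2 * of_bool (f \<in> hp ` level i)
      + 2 * of_bool (f \<in> hp ` level (Suc i)))"
    by (intro sum_mono edge_level_bound i)
  also have "\<dots> = 3 * card (thick k i) + card (thick k (i - 1)) + card (thick k (Suc i))
      + 2 * card (H \<inter> hp ` level i) + 2 * card (H \<inter> hp ` level (Suc i))"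
    by (simp only: sum.distrib sum_distrib_left[symmetric] ind sub)
  also have "\<dots> \<le> 3 * card (thick k i) + card (thick k (i - 1)) + card (thick k (Suc i))
      + 2 * card (level i) + 2 * card (level (Suc i))"
    using img[of i] img[of "Suc i"] by linarith
  finally show ?thesis .
qed

text \<open>Summing degrees over level \<open>i\<close> leaves only the next level to absorb the
  term with \<open>\<rho>\<close>. For \<open>i = 0\<close> the index \<open>i - 1\<close> is again
  \<open>0\<close>, so the monotonicity hypothesis holds trivially.\<close>

lemma level_growth:
  fixes \<rho> :: real
  assumes free: "\<not> has_berge_cycle H (2 * k + 1)" and k: "2 \<le> k" and i: "i < k"
    and deg: "\<And>v. v \<in> R \<Longrightarrow> 2 * k * \<rho> + 9 * k < card {f \<in> H. v \<in> f}"
    and ne: "level i \<noteq> {}" and prev: "card (level (i - 1)) \<le> card (level i)"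
  shows "\<rho> * card (level i) < card (level (Suc i))"
proof -
  let ?g = "\<lambda>j. real (card (level j))"
  have thick: "real (card (thick k j)) \<le> (2 * real k - 2) * ?g j" if "j \<le> k" for j
  proof -
    have "real (card (thick k j)) \<le> real ((2 * k - 2) * card (level j))"
      using card_thick[OF free k that] by (simp only: of_nat_le_iff)
    also have "\<dots> = (2 * real k - 2) * ?g j" using k by (simp add: of_nat_diff)
    finally show ?thesis .
  qed
  have pos: "0 < ?g i" using ne finite_level by (simp add: card_gt_0_iff)
  have "(2 * k * \<rho> + 9 * k) * ?g i = (\<Sum>v\<in>level i. 2 * k * \<rho> + 9 * k)" by simp
  also have "\<dots> < (\<Sum>v\<in>level i. real (card {f \<in> H. v \<in> f}))"
    by (rule sum_strict_mono[OF finite_level ne]) (use deg in \<open>simp add: level_def\<close>)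
  also have "\<dots> = real (\<Sum>v\<in>level i. card {f \<in> H. v \<in> f})" by simp
  also have "\<dots> \<le> real (3 * card (thick k i) + card (thick k (i - 1))
      + card (thick k (Suc i)) + 2 * card (level i) + 2 * card (level (Suc i)))"
    using degree_count[OF i] by (simp only: of_nat_le_iff)
  also have "\<dots> \<le> 3 * ((2 * real k - 2) * ?g i) + (2 * real k - 2) * ?g i
      + (2 * real k - 2) * ?g (Suc i) + 2 * ?g i + 2 * ?g (Suc i)"
  proof -
    have "(2 * real k - 2) * ?g (i - 1) \<le> (2 * real k - 2) * ?g i"
      using prev k by (intro mult_left_mono) auto
    moreover have "i \<le> k" "i - 1 \<le> k" "Suc i \<le> k" using i by auto
    ultimately show ?thesis
      using thick[of i] thick[of "i - 1"] thick[of "Suc i"]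
      by (simp only: of_nat_add of_nat_mult of_nat_numeral) argo
  qed
  also have "\<dots> = (8 * k - 6) * ?g i + 2 * k * ?g (Suc i)"
    using k by (simp add: of_nat_diff algebra_simps)
  also have "\<dots> \<le> 9 * k * ?g i + 2 * k * ?g (Suc i)"
    using pos by (intro add_right_mono mult_right_mono) auto
  finally have "2 * k * (\<rho> * ?g i) < 2 * k * ?g (Suc i)" by (simp add: algebra_simps)
  then show ?thesis using k by simp
qed

text \<open>The induction also carries nonemptiness and monotonicity, which
  \<open>level_growth\<close> consumes. Strictness is claimed only from level 1 on, since level 0
  may be a single vertex.\<close>

lemma top_level_bound:
  fixes \<rho> :: real
  assumes free: "\<not> has_berge_cycle H (2 * k + 1)" and k: "2 \<le> k" and \<rho>: "1 \<le> \<rho>"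
    and deg: "\<And>v. v \<in> R \<Longrightarrow> 2 * k * \<rho> + 9 * k < card {f \<in> H. v \<in> f}"
    and x: "x \<in> R" "lev x = 0"
  shows "\<rho> ^ k < card (level k)"
proof -
  have "i \<le> k \<Longrightarrow> level i \<noteq> {} \<and> card (level (i - 1)) \<le> card (level i) \<and> \<rho> ^ i \<le> card (level i)
      \<and> (0 < i \<longrightarrow> \<rho> ^ i < card (level i))" for i
  proof (induction i)
    case 0
    have "level 0 \<noteq> {}" using x by (auto simp: level_def)
    then have "0 < card (level 0)" using finite_level by (simp add: card_gt_0_iff)
    then show ?case using \<open>level 0 \<noteq> {}\<close> by simp
  next
    case (Suc i)
    then have IH: "level i \<noteq> {}" "card (level (i - 1)) \<le> card (level i)" "\<rho> ^ i \<le> card (level i)"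
      by auto
    have g: "\<rho> * card (level i) < card (level (Suc i))"
      using level_growth[OF free k _ deg IH(1,2)] Suc.prems by simp
    have "1 * real (card (level i)) \<le> \<rho> * card (level i)" using \<rho> by (intro mult_right_mono) auto
    then have le: "card (level i) < card (level (Suc i))" using g by simp
    have "\<rho> * \<rho> ^ i \<le> \<rho> * card (level i)" using IH(3) \<rho> by (intro mult_left_mono) auto
    then have "\<rho> ^ Suc i < card (level (Suc i))" using g by simp
    moreover have "level (Suc i) \<noteq> {}" using le by auto
    ultimately show ?case using le by simp
  qed
  from this[of k] show ?thesis using k by simp
qed

end

section \<open>Existence of the tree and the edge bound\<close>

primrec bfs_ball :: "'a set set \<Rightarrow> 'a \<Rightarrow> nat \<Rightarrow> 'a set" where
  "bfs_ball H x 0 = {x}"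
| "bfs_ball H x (Suc n) = bfs_ball H x n \<union> \<Union>{f \<in> H. f \<inter> bfs_ball H x n \<noteq> {}}"

text \<open>\<open>R\<close> is the union of all balls, the component of \<open>x\<close>. An edge
  that meets it lies inside it, so restricting to \<open>R\<close> preserves degrees.\<close>

lemma bfs_tree_exists:
  assumes U: "finite U" "x \<in> U" and H: "uniform3_on U H" "linear_hg H"
  obtains R lev par hp where "R \<subseteq> U" "x \<in> R" "lev x = (0::nat)"
    "bfs_tree {f \<in> H. f \<subseteq> R} R lev par hp" "\<And>f. f \<in> H \<Longrightarrow> f \<inter> R \<noteq> {} \<Longrightarrow> f \<subseteq> R"
proof -
  let ?B = "bfs_ball H x"
  define R where "R = (\<Union>n. ?B n)"
  define lev where "lev y = (LEAST n. y \<in> ?B n)" for y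
  have BU: "?B n \<subseteq> U" for n
    by (induction n) (use U(2) H(1) in \<open>auto simp: uniform3_on_def\<close>)
  have levB: "y \<in> ?B (lev y)" if "y \<in> R" for y
    using that unfolding R_def lev_def by (auto intro: LeastI)
  have lev_le: "lev y \<le> n" if "y \<in> ?B n" for y n
    unfolding lev_def using that by (rule Least_le)
  have edge: "v \<in> ?B (Suc n)" if "f \<in> H" "u \<in> f" "v \<in> f" "u \<in> ?B n" for f u v n
    using that by auto
  have closed: "f \<subseteq> R" if fH: "f \<in> H" and meets: "f \<inter> R \<noteq> {}" for f
  proof
    fix v assume "v \<in> f"
    moreover obtain u n where "u \<in> f" "u \<in> ?B n" using meets unfolding R_def by blast
    ultimately have "v \<in> ?B (Suc n)" using edge fH by blast
    then show "v \<in> R" unfolding R_def by blast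
  qed
  have ex: "\<exists>f q. f \<in> H \<and> y \<in> f \<and> q \<in> f \<and> Suc (lev q) = lev y" if y: "y \<in> R" "0 < lev y" for y
  proof -
    obtain n where n: "lev y = Suc n" using y(2) by (cases "lev y") auto
    have "y \<notin> ?B n" using lev_le[of y n] n by auto
    moreover have "y \<in> ?B (Suc n)" using levB[OF y(1)] n by simp
    ultimately obtain f q where fq: "f \<in> H" "y \<in> f" "q \<in> f" "q \<in> ?B n" by auto
    have qR: "q \<in> R" using fq(4) by (auto simp: R_def)
    have "y \<in> ?B (Suc (lev q))" using edge[OF fq(1,3,2) levB[OF qR]] .
    then have "lev y \<le> Suc (lev q)" by (rule lev_le)
    moreover have "lev q \<le> n" using lev_le fq(4) .
    ultimately show ?thesis using fq n by auto
  qed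
  define hp where "hp y = (SOME f. \<exists>q. f \<in> H \<and> y \<in> f \<and> q \<in> f \<and> Suc (lev q) = lev y)" for y
  define par where "par y = (SOME q. q \<in> hp y \<and> Suc (lev q) = lev y)" for y
  have hp: "\<exists>q. hp y \<in> H \<and> y \<in> hp y \<and> q \<in> hp y \<and> Suc (lev q) = lev y" if "y \<in> R" "0 < lev y" for y
    unfolding hp_def using ex[OF that] by (rule someI_ex)
  have par: "par y \<in> hp y \<and> Suc (lev (par y)) = lev y" if "y \<in> R" "0 < lev y" for y
    unfolding par_def by (rule someI_ex) (use hp[OF that] in blast)
  have "x \<in> ?B 0" by simp
  then have x: "x \<in> R" "lev x = 0" using lev_le[of x 0] by (auto simp: R_def simp del: bfs_ball.simps)
  have "R \<subseteq> U" using BU by (auto simp: R_def)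
  have "bfs_tree {f \<in> H. f \<subseteq> R} R lev par hp"
  proof
    show "finite R" using \<open>R \<subseteq> U\<close> U(1) finite_subset by blast
    show "uniform3_on R {f \<in> H. f \<subseteq> R}" using H(1) by (simp add: uniform3_on_def)
    show "linear_hg {f \<in> H. f \<subseteq> R}" using H(2) by (simp add: linear_hg_def)
    show "lev v \<le> Suc (lev u)" if "f \<in> {f \<in> H. f \<subseteq> R}" "u \<in> f" "v \<in> f" for f u v
    proof -
      have "u \<in> ?B (lev u)" using that levB by blast
      then have "v \<in> ?B (Suc (lev u))" using edge[of f u v] that by blast
      then show ?thesis by (rule lev_le)
    qed
    show "u = v" if "u \<in> R" "v \<in> R" "lev u = 0" "lev v = 0" for u v
      using levB[OF that(1)] levB[OF that(2)] that(3,4) by simp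
    show "hp y \<in> {f \<in> H. f \<subseteq> R} \<and> y \<in> hp y \<and> par y \<in> hp y \<and> Suc (lev (par y)) = lev y"
      if "y \<in> R" "0 < lev y" for y
    proof -
      have "hp y \<in> H" "y \<in> hp y" using hp[OF that] by auto
      then have "hp y \<subseteq> R" using closed that(1) by blast
      then show ?thesis using par[OF that] \<open>hp y \<in> H\<close> \<open>y \<in> hp y\<close> by blast
    qed
  qed
  then show thesis using that \<open>R \<subseteq> U\<close> x closed by blast
qed

lemma has_berge_cycle_mono: "has_berge_cycle H m \<Longrightarrow> H \<subseteq> H' \<Longrightarrow> has_berge_cycle H' m"
  unfolding has_berge_cycle_def by (meson order_trans)

lemma card_edges_le:
  fixes H :: "'a set set"
  assumes V: "finite V" "V \<noteq> {}" and H: "uniform3_on V H" "linear_hg H"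
    and free: "\<not> has_berge_cycle H (2 * k + 1)" and k: "2 \<le> k"
  shows "card H \<le> (2 * real k * card V powr (1 / k) + 9 * real k) * card V"
proof (rule ccontr)
  \<comment> \<open>The size of the original vertex set is used, not that of the part found later:
    the levels lie in \<open>V\<close>, so growth beyond \<open>\<rho> ^ k = card V\<close> is
    already impossible.\<close>
  define \<rho> where "\<rho> = card V powr (1 / k)"
  assume "\<not> ?thesis"
  then have dense: "(2 * real k * \<rho> + 9 * real k) * card V < card H" by (simp add: \<rho>_def)
  have Vpos: "1 \<le> real (card V)" using V by (simp add: Suc_leI card_gt_0_iff)
  then have \<rho>1: "1 \<le> \<rho>" by (simp add: \<rho>_def ge_one_powr_ge_zero)
  have \<rho>k: "\<rho> ^ k = card V"
    using Vpos k by (simp add: \<rho>_def powr_power)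
  have "finite H" by (rule finite_subset[of H "Pow V"]) (use H(1) V in \<open>auto simp: uniform3_on_def\<close>)
  have HV: "f \<subseteq> V \<and> f \<noteq> {}" if "f \<in> H" for f
    using H(1) that by (fastforce simp: uniform3_on_def)
  obtain U where U: "U \<subseteq> V" "U \<noteq> {}"
    "\<And>u. u \<in> U \<Longrightarrow> 2 * real k * \<rho> + 9 * real k < card {f \<in> H. u \<in> f \<and> f \<subseteq> U}"
    using dense_family_min_degree[where p = "\<lambda>f. f", OF V(1) \<open>finite H\<close> HV dense] by blast
  define H' where "H' = {f \<in> H. f \<subseteq> U}"
  have H': "uniform3_on U H'" "linear_hg H'"
    using H by (auto simp: H'_def uniform3_on_def linear_hg_def)
  have finU: "finite U" using U(1) V(1) finite_subset by blast
  obtain x where "x \<in> U" using U(2) by blast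
  obtain R lev par hp where R: "R \<subseteq> U" "x \<in> R" "lev x = (0::nat)"
    "bfs_tree {f \<in> H'. f \<subseteq> R} R lev par hp" "\<And>f. f \<in> H' \<Longrightarrow> f \<inter> R \<noteq> {} \<Longrightarrow> f \<subseteq> R"
    using bfs_tree_exists[OF finU \<open>x \<in> U\<close> H'] by blast
  interpret bfs_tree "{f \<in> H'. f \<subseteq> R}" R lev par hp by (rule R(4))
  have free': "\<not> has_berge_cycle {f \<in> H'. f \<subseteq> R} (2 * k + 1)"
    using free has_berge_cycle_mono[of "{f \<in> H'. f \<subseteq> R}" _ H] by (auto simp: H'_def)
  have deg: "2 * real k * \<rho> + 9 * real k < card {f \<in> {f \<in> H'. f \<subseteq> R}. v \<in> f}" if v: "v \<in> R" for v
  proof -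
    have "{f \<in> {f \<in> H'. f \<subseteq> R}. v \<in> f} = {f \<in> H. v \<in> f \<and> f \<subseteq> U}"
      using R(5) v by (auto simp: H'_def)
    then show ?thesis using U(3)[of v] R(1) v by auto
  qed
  have "\<rho> ^ k < card (level k)" by (rule top_level_bound[OF free' k \<rho>1 deg R(2,3)])
  moreover have "card (level k) \<le> card V"
    by (rule card_mono[OF V(1)]) (use R(1) U(1) in \<open>auto simp: level_def\<close>)
  ultimately show False using \<rho>k by simp
qed

theorem theorem3:
  fixes k n :: nat
  assumes "k \<ge> 2" and "n \<ge> 1"
  shows "real (ex_lin3 n (2 * k + 1))
           \<le> 2 * real k * real n powr (1 + 1 / real k) + 9 * real k * real n"
proof -
  define S where "S = {card H | H :: nat set set.
      uniform3_on {..<n} H \<and> linear_hg H \<and> \<not> has_berge_cycle H (2 * k + 1)}"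
  have "S \<subseteq> card ` Pow (Pow {..<n})" by (auto simp: S_def uniform3_on_def)
  then have "finite S" by (rule finite_subset) simp
  moreover have "uniform3_on {..<n} {}" "linear_hg {}" "\<not> has_berge_cycle {} (2 * k + 1)"
    by (auto simp: uniform3_on_def linear_hg_def has_berge_cycle_def)
  then have "S \<noteq> {}" unfolding S_def by blast
  ultimately have "Max S \<in> S" by (rule Max_in)
  then obtain H :: "nat set set" where H: "ex_lin3 n (2 * k + 1) = card H" "uniform3_on {..<n} H"
      "linear_hg H" "\<not> has_berge_cycle H (2 * k + 1)"
    unfolding ex_lin3_def S_def[symmetric] by (auto simp: S_def)
  have "{..<n} \<noteq> {}" using assms(2) by (auto simp: lessThan_empty_iff)
  then have "card H \<le> (2 * real k * real n powr (1 / real k) + 9 * real k) * real n"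
    using card_edges_le[OF _ _ H(2-4) assms(1)] by simp
  also have "\<dots> = 2 * real k * real n powr (1 + 1 / real k) + 9 * real k * real n"
    using assms(2) by (simp add: powr_add algebra_simps)
  finally show ?thesis unfolding H(1) .
qed

end
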